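(* If $\kappa$ is an internally AP subtle cardinal, then $\mathrm{SSP}(\kappa)$ holds.
   Context: $\mathrm{H}(\theta)$ is the set of all sets whose transitive closure has cardinality less than $\theta$. An elementary embedding $j:M\to N$ between transitive classes is non-trivial if there is an ordinal $\alpha\in M$ with $j(\alpha)>\alpha$; then $\mathrm{crit}(j)$ denotes the least such ordinal. Given cardinals $\kappa<\theta$, a non-trivial elementary embedding $j:M\to \mathrm{H}(\theta)$ is a small embedding for $\kappa$ if $M\in \mathrm{H}(\theta)$ is transitive and $j(\mathrm{crit}(j))=\kappa$. "For all sufficiently large regular cardinals $\theta$" means: there is an ordinal $\alpha\geq\kappa$ such that the statement holds for all regular cardinals $\theta>\alpha$. Given transitive classes $M\subseteq N$, the pair $(M,N)$ satisfies the $\omega_1$-approximation property if $A\in M$ whenever $A\in N$ is such that $A\subseteq B$ for some $B\in M$, and $A\cap x\in M$ for every $x\in M$ which is countable in $M$. A $\kappa$-list is a sequence $\langle d_\alpha\mid\alpha<\kappa\rangle$ with $d_\alpha\subseteq\alpha$ for all $\alpha<\kappa$. $\mathcal{P}_{\omega_1}(X)$ is the set of countable subsets of $X$. A cardinal $\kappa$ is internally AP subtle if for all sufficiently large regular cardinals $\theta$, all $x\in \mathrm{H}(\theta)$, every club $C$ in $\kappa$, and every $\kappa$-list $\vec d=\langle d_\alpha\mid\alpha<\kappa\rangle$, there is a small embedding $j:M\to \mathrm{H}(\theta)$ for $\kappa$ and a transitive model $N$ of $\mathrm{ZFC}^-$ such that $x,\vec d,C\in\mathrm{ran}(j)$ and: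 (i) $N\subseteq \mathrm{H}(\theta)$ and the pair $(N,\mathrm{H}(\theta))$ satisfies the $\omega_1$-approximation property; (ii) $M\in N$ and $\mathcal{P}_{\omega_1}(\mathrm{crit}(j))^N\subseteq M$; (iii) if $d_{\mathrm{crit}(j)}\in N$, then there is an $\alpha<\mathrm{crit}(j)$ with $\alpha\in C$ and $d_\alpha=d_{\mathrm{crit}(j)}\cap\alpha$. For an uncountable regular cardinal $\kappa$, a $\kappa$-list $\langle d_\alpha\mid\alpha<\kappa\rangle$ is slender if there is a club $C$ in $\kappa$ such that for every $\gamma\in C$ and every $\alpha<\gamma$, there is a $\beta<\gamma$ with $d_\gamma\cap\alpha=d_\beta\cap\alpha$. $\mathrm{SSP}(\kappa)$ is the statement that for every slender $\kappa$-list $\langle d_\alpha\mid\alpha<\kappa\rangle$ and every club $C$ in $\kappa$, there are $\alpha,\beta\in C$ such that $\alpha<\beta$ and $d_\alpha=d_\beta\cap\alpha$. *)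

theory Defs
  imports Main "HOL-Library.Equipollence" "HOL-Library.Countable_Set"
begin

text \<open>Formulas of the language of set theory, with named variables.\<close>

datatype fm =
    FMem nat nat
  | FEq nat nat
  | FNeg fm
  | FAnd fm fm
  | FEx nat fm

text \<open>
  A universe of ZFC sets, given by the map sending each set to the collection of its elements.
  Separation and replacement hold for arbitrary HOL predicates and functions. Consequently:
  every HOL function between (the element collections of) two sets has a set as its graph, so
  HOL functions, injections and bijections may be used for the internal ones; and the internal
  natural numbers are standard, so the formulas of type fm are all the formulas that the
  universe knows about, and satisfaction in set-sized structures is the external one.
\<close>

locale ZFC_universe =
  fixes elts :: "'v \<Rightarrow> 'v set"
  assumes extensionality: "elts x = elts y \<Longrightarrow> x = y"
    and foundation: "elts x \<noteq> {} \<Longrightarrow> \<exists>y\<in>elts x. elts y \<inter> elts x = {}"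
    and pairing: "\<exists>z. elts z = {x, y}"
    and union: "\<exists>u. elts u = (\<Union>y\<in>elts x. elts y)"
    and powerset: "\<exists>p. elts p = {y. elts y \<subseteq> elts x}"
    and infinity: "\<exists>w. (\<exists>e\<in>elts w. elts e = {}) \<and>
                      (\<forall>x\<in>elts w. \<exists>y\<in>elts w. elts y = insert x (elts x))"
    and separation: "\<exists>y. elts y = {z \<in> elts x. P z}"
    and replacement: "\<exists>y. elts y = F ` elts x"
    and choice: "\<lbrakk>\<forall>y\<in>elts x. elts y \<noteq> {};
                  \<forall>y\<in>elts x. \<forall>z\<in>elts x. y \<noteq> z \<longrightarrow> elts y \<inter> elts z = {}\<rbrakk>
                 \<Longrightarrow> \<exists>c. \<forall>y\<in>elts x. \<exists>!z. z \<in> elts c \<and> z \<in> elts y"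
begin

text \<open>Only meaningful when the collection is the extension of a set.\<close>

definition set_of :: "'v set \<Rightarrow> 'v" where
  "set_of A = (THE x. elts x = A)"

definition opair :: "'v \<Rightarrow> 'v \<Rightarrow> 'v" where
  "opair a b = set_of {set_of {a}, set_of {a, b}}"

definition function_on :: "'v \<Rightarrow> 'v \<Rightarrow> bool" where
  "function_on f a \<longleftrightarrow>
     (\<forall>p\<in>elts f. \<exists>u\<in>elts a. \<exists>v. p = opair u v) \<and>
     (\<forall>u\<in>elts a. \<exists>!v. opair u v \<in> elts f)"

definition app :: "'v \<Rightarrow> 'v \<Rightarrow> 'v" where
  "app f u = (THE v. opair u v \<in> elts f)"

text \<open>Transitivity is a property of classes; a set is transitive if its class of elements is.\<close>

definition transitive :: "'v set \<Rightarrow> bool" where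
  "transitive M \<longleftrightarrow> (\<forall>x\<in>M. elts x \<subseteq> M)"

text \<open>By Foundation, a transitive set linearly ordered by membership is well-ordered by it.\<close>

definition Ord :: "'v \<Rightarrow> bool" where
  "Ord \<alpha> \<longleftrightarrow> transitive (elts \<alpha>) \<and>
     (\<forall>x\<in>elts \<alpha>. \<forall>y\<in>elts \<alpha>. x \<in> elts y \<or> x = y \<or> y \<in> elts x)"

definition Limit :: "'v \<Rightarrow> bool" where
  "Limit \<delta> \<longleftrightarrow> Ord \<delta> \<and> elts \<delta> \<noteq> {} \<and> (\<forall>\<alpha>\<in>elts \<delta>. \<exists>\<beta>\<in>elts \<delta>. \<alpha> \<in> elts \<beta>)"

definition omega :: 'v where
  "omega = set_of {n. Ord n \<and> finite (elts n)}"

definition Card :: "'v \<Rightarrow> bool" where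
  "Card \<kappa> \<longleftrightarrow> Ord \<kappa> \<and> (\<forall>\<alpha>\<in>elts \<kappa>. \<not> elts \<alpha> \<approx> elts \<kappa>)"

definition regular :: "'v \<Rightarrow> bool" where
  "regular \<theta> \<longleftrightarrow> Card \<theta> \<and> infinite (elts \<theta>) \<and>
     (\<forall>\<mu>\<in>elts \<theta>. \<forall>f. f ` elts \<mu> \<subseteq> elts \<theta> \<longrightarrow>
        (\<exists>\<beta>\<in>elts \<theta>. \<forall>\<xi>\<in>elts \<mu>. f \<xi> \<in> elts \<beta>))"

definition trans_closure :: "'v \<Rightarrow> 'v set" where
  "trans_closure x = {y. tranclp (\<lambda>u v. u \<in> elts v) y x}"

definition H :: "'v \<Rightarrow> 'v set" where
  "H \<theta> = {x. trans_closure x \<prec> elts \<theta>}"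

primrec sat :: "'v set \<Rightarrow> fm \<Rightarrow> (nat \<Rightarrow> 'v) \<Rightarrow> bool" where
  "sat M (FMem i k) s \<longleftrightarrow> s i \<in> elts (s k)"
| "sat M (FEq i k) s \<longleftrightarrow> s i = s k"
| "sat M (FNeg \<phi>) s \<longleftrightarrow> \<not> sat M \<phi> s"
| "sat M (FAnd \<phi> \<psi>) s \<longleftrightarrow> sat M \<phi> s \<and> sat M \<psi> s"
| "sat M (FEx i \<phi>) s \<longleftrightarrow> (\<exists>a\<in>M. sat M \<phi> (s(i := a)))"

definition elementary_embedding :: "('v \<Rightarrow> 'v) \<Rightarrow> 'v set \<Rightarrow> 'v set \<Rightarrow> bool" where
  "elementary_embedding j M N \<longleftrightarrow> j ` M \<subseteq> N \<and>
     (\<forall>\<phi> s. range s \<subseteq> M \<longrightarrow> (sat M \<phi> s \<longleftrightarrow> sat N \<phi> (j \<circ> s)))"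

definition nontrivial :: "('v \<Rightarrow> 'v) \<Rightarrow> 'v set \<Rightarrow> bool" where
  "nontrivial j M \<longleftrightarrow> (\<exists>\<alpha>\<in>M. Ord \<alpha> \<and> \<alpha> \<in> elts (j \<alpha>))"

definition crit :: "('v \<Rightarrow> 'v) \<Rightarrow> 'v set \<Rightarrow> 'v" where
  "crit j M = (THE \<alpha>. \<alpha> \<in> M \<and> Ord \<alpha> \<and> \<alpha> \<in> elts (j \<alpha>) \<and>
     (\<forall>\<beta>\<in>M. Ord \<beta> \<and> \<beta> \<in> elts (j \<beta>) \<longrightarrow> \<alpha> = \<beta> \<or> \<alpha> \<in> elts \<beta>))"

definition small_embedding :: "'v \<Rightarrow> 'v \<Rightarrow> 'v \<Rightarrow> ('v \<Rightarrow> 'v) \<Rightarrow> bool" where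
  "small_embedding \<kappa> \<theta> M j \<longleftrightarrow>
     Card \<kappa> \<and> Card \<theta> \<and> \<kappa> \<in> elts \<theta> \<and>
     M \<in> H \<theta> \<and> transitive (elts M) \<and>
     elementary_embedding j (elts M) (H \<theta>) \<and> nontrivial j (elts M) \<and>
     j (crit j (elts M)) = \<kappa>"

text \<open>
  The axioms of ZFC without Power Set, relativized to N. Parameters of the schemes are supplied
  by the assignment. With Replacement rather than Collection, and Choice in the form of
  selectors, this is the weakest of the theories customarily denoted ZFC with a superscript minus.
\<close>

definition ZFC_minus_model :: "'v set \<Rightarrow> bool" where
  "ZFC_minus_model N \<longleftrightarrow>
     \<comment> \<open>Extensionality\<close>
     (\<forall>x\<in>N. \<forall>y\<in>N. (\<forall>z\<in>N. z \<in> elts x \<longleftrightarrow> z \<in> elts y) \<longrightarrow> x = y) \<and>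
     \<comment> \<open>Foundation\<close>
     (\<forall>x\<in>N. (\<exists>y\<in>N. y \<in> elts x) \<longrightarrow>
        (\<exists>y\<in>N. y \<in> elts x \<and> \<not> (\<exists>z\<in>N. z \<in> elts y \<and> z \<in> elts x))) \<and>
     \<comment> \<open>Pairing\<close>
     (\<forall>x\<in>N. \<forall>y\<in>N. \<exists>z\<in>N. \<forall>w\<in>N. w \<in> elts z \<longleftrightarrow> w = x \<or> w = y) \<and>
     \<comment> \<open>Union\<close>
     (\<forall>x\<in>N. \<exists>u\<in>N. \<forall>w\<in>N. w \<in> elts u \<longleftrightarrow> (\<exists>y\<in>N. y \<in> elts x \<and> w \<in> elts y)) \<and>
     \<comment> \<open>Infinity\<close>
     (\<exists>w\<in>N. (\<exists>e\<in>N. e \<in> elts w \<and> (\<forall>z\<in>N. z \<notin> elts e)) \<and>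
        (\<forall>x\<in>N. x \<in> elts w \<longrightarrow>
           (\<exists>y\<in>N. y \<in> elts w \<and> (\<forall>z\<in>N. z \<in> elts y \<longleftrightarrow> z = x \<or> z \<in> elts x)))) \<and>
     \<comment> \<open>Separation\<close>
     (\<forall>\<phi> s. range s \<subseteq> N \<longrightarrow>
        (\<forall>x\<in>N. \<exists>y\<in>N. \<forall>z\<in>N. z \<in> elts y \<longleftrightarrow> z \<in> elts x \<and> sat N \<phi> (s(0 := z)))) \<and>
     \<comment> \<open>Replacement\<close>
     (\<forall>\<phi> s. range s \<subseteq> N \<longrightarrow>
        (\<forall>x\<in>N.
           (\<forall>u\<in>N. u \<in> elts x \<longrightarrow> (\<exists>!v. v \<in> N \<and> sat N \<phi> (s(0 := u, 1 := v)))) \<longrightarrow>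
           (\<exists>y\<in>N. \<forall>v\<in>N. v \<in> elts y \<longleftrightarrow>
              (\<exists>u\<in>N. u \<in> elts x \<and> sat N \<phi> (s(0 := u, 1 := v)))))) \<and>
     \<comment> \<open>Choice\<close>
     (\<forall>x\<in>N.
        (\<forall>y\<in>N. y \<in> elts x \<longrightarrow> (\<exists>z\<in>N. z \<in> elts y)) \<and>
        (\<forall>y\<in>N. \<forall>z\<in>N. y \<in> elts x \<and> z \<in> elts x \<and> y \<noteq> z \<longrightarrow>
           \<not> (\<exists>w\<in>N. w \<in> elts y \<and> w \<in> elts z)) \<longrightarrow>
        (\<exists>c\<in>N. \<forall>y\<in>N. y \<in> elts x \<longrightarrow> (\<exists>!z. z \<in> N \<and> z \<in> elts c \<and> z \<in> elts y)))"

text \<open>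
  Being an injection from x into omega is absolute for transitive models, so relativization only
  restricts where the injection is to be found.
\<close>

definition countable_in :: "'v set \<Rightarrow> 'v \<Rightarrow> bool" where
  "countable_in N x \<longleftrightarrow>
     (\<exists>f\<in>N. function_on f x \<and> (\<forall>u\<in>elts x. app f u \<in> elts omega) \<and> inj_on (app f) (elts x))"

definition omega1_approximation :: "'v set \<Rightarrow> 'v set \<Rightarrow> bool" where
  "omega1_approximation M N \<longleftrightarrow>
     (\<forall>A\<in>N. (\<exists>B\<in>M. elts A \<subseteq> elts B) \<and>
        (\<forall>x\<in>M. countable_in M x \<longrightarrow> set_of (elts A \<inter> elts x) \<in> M) \<longrightarrow> A \<in> M)"

text \<open>
  Unboundedness is non-strict, so that it is also adequate for ordinals which are not limits
  (in particular every ordinal is unbounded, hence club, in itself).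
\<close>

definition unbounded_in :: "'v \<Rightarrow> 'v \<Rightarrow> bool" where
  "unbounded_in C \<delta> \<longleftrightarrow>
     (\<forall>\<alpha>\<in>elts \<delta>. \<exists>\<beta>\<in>elts C \<inter> elts \<delta>. \<alpha> = \<beta> \<or> \<alpha> \<in> elts \<beta>)"

definition club :: "'v \<Rightarrow> 'v \<Rightarrow> bool" where
  "club C \<kappa> \<longleftrightarrow> elts C \<subseteq> elts \<kappa> \<and> unbounded_in C \<kappa> \<and>
     (\<forall>\<delta>\<in>elts \<kappa>. Limit \<delta> \<and> unbounded_in C \<delta> \<longrightarrow> \<delta> \<in> elts C)"

definition kappa_list :: "'v \<Rightarrow> 'v \<Rightarrow> bool" where
  "kappa_list \<kappa> d \<longleftrightarrow> function_on d \<kappa> \<and> (\<forall>\<alpha>\<in>elts \<kappa>. elts (app d \<alpha>) \<subseteq> elts \<alpha>)"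

definition internally_AP_subtle :: "'v \<Rightarrow> bool" where
  "internally_AP_subtle \<kappa> \<longleftrightarrow> Card \<kappa> \<and>
     (\<exists>\<alpha>0. Ord \<alpha>0 \<and> (\<alpha>0 = \<kappa> \<or> \<kappa> \<in> elts \<alpha>0) \<and>
       (\<forall>\<theta>. regular \<theta> \<and> \<alpha>0 \<in> elts \<theta> \<longrightarrow>
         (\<forall>x\<in>H \<theta>. \<forall>C d. club C \<kappa> \<and> kappa_list \<kappa> d \<longrightarrow>
           (\<exists>M j N. small_embedding \<kappa> \<theta> M j \<and>
              transitive (elts N) \<and> ZFC_minus_model (elts N) \<and>
              {x, d, C} \<subseteq> j ` elts M \<and>
              (elts N \<subseteq> H \<theta> \<and> omega1_approximation (elts N) (H \<theta>)) \<and>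
              (M \<in> elts N \<and>
               {a \<in> elts N. elts a \<subseteq> elts (crit j (elts M)) \<and> countable_in (elts N) a}
                 \<subseteq> elts M) \<and>
              (app d (crit j (elts M)) \<in> elts N \<longrightarrow>
                (\<exists>\<alpha>\<in>elts (crit j (elts M)). \<alpha> \<in> elts C \<and>
                   elts (app d \<alpha>) = elts (app d (crit j (elts M))) \<inter> elts \<alpha>))))))"

definition slender :: "'v \<Rightarrow> 'v \<Rightarrow> bool" where
  "slender \<kappa> d \<longleftrightarrow>
     (\<exists>C. club C \<kappa> \<and>
        (\<forall>\<gamma>\<in>elts C. \<forall>\<alpha>\<in>elts \<gamma>. \<exists>\<beta>\<in>elts \<gamma>.
           elts (app d \<gamma>) \<inter> elts \<alpha> = elts (app d \<beta>) \<inter> elts \<alpha>))"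

text \<open>
  The principle is only formulated for uncountable regular cardinals; this presupposition is made
  part of the principle.
\<close>

definition SSP :: "'v \<Rightarrow> bool" where
  "SSP \<kappa> \<longleftrightarrow> regular \<kappa> \<and> uncountable (elts \<kappa>) \<and>
     (\<forall>d C. kappa_list \<kappa> d \<and> slender \<kappa> d \<and> club C \<kappa> \<longrightarrow>
        (\<exists>\<alpha>\<in>elts C. \<exists>\<beta>\<in>elts C. \<alpha> \<in> elts \<beta> \<and>
           elts (app d \<alpha>) = elts (app d \<beta>) \<inter> elts \<alpha>))"

end

end

theory Submission
  imports Defs
begin

text \<open>
  Let \<open>d\<close> be a slender \<open>\<kappa>\<close>-list, with slenderness witnessed by a club \<open>C\<^sub>0\<close>, and let \<open>C\<close> be a
  club. Take a small embedding \<open>j\<close> of \<open>M\<close> with critical point \<open>\<delta>\<close> and an inner model \<open>N\<close> as in the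
  definition of internal AP subtlety, with \<open>d\<close>, \<open>C\<close> and \<open>C\<^sub>0\<close> in the range of \<open>j\<close>. By
  elementarity \<open>\<delta>\<close> is a limit point of both clubs, hence a member of both. If the value of \<open>d\<close> at
  \<open>\<delta>\<close> belongs to \<open>N\<close>, then it is guessed by the value at some \<open>\<alpha> < \<delta>\<close> in \<open>C\<close>, and the pair
  \<open>\<alpha> < \<delta>\<close> is as required.

  That the value belongs to \<open>N\<close> follows from the approximation property
  (\<open>slender_value_in_model\<close>). Its trace on a countable set of \<open>N\<close> is its trace on a countable
  subset \<open>a\<close> of \<open>\<delta>\<close>. If \<open>a\<close> is bounded below \<open>\<delta>\<close>, slenderness replaces the value at \<open>\<delta>\<close> by
  the value at some \<open>\<beta> < \<delta>\<close>, and the values below \<open>\<delta>\<close> are not moved by \<open>j\<close>, so they lie in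
  \<open>M \<subseteq> N\<close>.

  The boundedness of \<open>a\<close> (\<open>countable_subset_bounded\<close>) needs an argument, since an enumeration of
  \<open>a\<close> that exists in \<open>N\<close> need not exist in \<open>M\<close>, and \<open>\<delta>\<close> need not be regular. If \<open>a\<close> were
  cofinal in \<open>\<delta>\<close>, the records of an enumeration of \<open>a\<close> would form a cofinal subset \<open>b\<close> of order
  type \<open>\<omega>\<close> in \<open>N\<close>. By the closure property of \<open>M\<close>, \<open>b\<close> belongs to \<open>M\<close>. Now \<open>j b\<close> extends \<open>b\<close>
  and so has the limit point \<open>\<delta> < \<kappa>\<close>; by elementarity \<open>b\<close> has a limit point below \<open>\<delta>\<close>, which is
  impossible for a cofinal set of type \<open>\<omega>\<close>.

  That \<open>\<kappa>\<close> is uncountable and regular also comes from the embeddings. The critical point is an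
  infinite ordinal below the cardinal \<open>\<kappa>\<close>. A function from some \<open>\<mu> < \<kappa>\<close> to \<open>\<kappa>\<close> in the range of
  \<open>j\<close> is bounded by \<open>\<delta>\<close>, once \<open>\<mu> < \<delta>\<close> has been arranged by a suitable choice of the club.
  To have arbitrary sets in the range of \<open>j\<close> one needs regular cardinals \<open>\<theta>\<close> beyond any given
  ordinal with the sets in \<open>H \<theta>\<close>; they are obtained as successor cardinals
  (\<open>large_regular_exists\<close>).
\<close>

section \<open>Sets and classes\<close>

context ZFC_universe
begin

definition small :: "'v set \<Rightarrow> bool" where
  "small S \<longleftrightarrow> (\<exists>x. elts x = S)"

lemma elts_set_of: "small S \<Longrightarrow> elts (set_of S) = S"
  unfolding small_def set_of_def by (metis (mono_tags, lifting) extensionality theI)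

lemma small_elts [simp]: "small (elts x)"
  unfolding small_def by blast

lemma small_subset: "small T \<Longrightarrow> S \<subseteq> T \<Longrightarrow> small S"
proof -
  assume "small T" "S \<subseteq> T"
  then obtain x where x: "elts x = T" unfolding small_def by blast
  obtain y where "elts y = {z \<in> elts x. z \<in> S}" using separation[of x "\<lambda>z. z \<in> S"] by blast
  then have "elts y = S" using x \<open>S \<subseteq> T\<close> by blast
  then show ?thesis unfolding small_def by blast
qed

lemma small_image: "small S \<Longrightarrow> small (F ` S)"
  unfolding small_def using replacement by metis

lemma small_UN:
  assumes "small S" "\<And>x. x \<in> S \<Longrightarrow> small (F x)"
  shows "small (\<Union>x\<in>S. F x)"
proof -
  obtain y where y: "elts y = (\<lambda>x. set_of (F x)) ` S"
    using small_image[OF assms(1)] unfolding small_def by blast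
  obtain u where "elts u = (\<Union>z\<in>elts y. elts z)" using union by blast
  then have "elts u = (\<Union>x\<in>S. F x)" using y assms(2) by (simp add: elts_set_of)
  then show ?thesis unfolding small_def by blast
qed

lemma small_doubleton: "small {x, y}"
  unfolding small_def by (rule pairing)

lemma small_singleton: "small {x}"
  using small_doubleton[of x x] by simp

lemma small_empty: "small {}"
  using small_subset[OF small_singleton] by blast

lemma small_Un: "small S \<Longrightarrow> small T \<Longrightarrow> small (S \<union> T)"
proof -
  assume S: "small S" and T: "small T"
  have "small (\<Union>x\<in>{set_of S, set_of T}. elts x)"
    by (rule small_UN[OF small_doubleton]) simp
  then show ?thesis using S T by (simp add: elts_set_of)
qed

lemma small_Pow: "small S \<Longrightarrow> small {y. elts y \<subseteq> S}"
  unfolding small_def using powerset by metis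

lemma set_of_inject: "small S \<Longrightarrow> small T \<Longrightarrow> set_of S = set_of T \<longleftrightarrow> S = T"
  by (metis elts_set_of)

lemma eq_set_of_iff: "small S \<Longrightarrow> x = set_of S \<longleftrightarrow> elts x = S"
  by (metis elts_set_of extensionality)

lemma elts_opair: "elts (opair a b) = {set_of {a}, set_of {a, b}}"
  unfolding opair_def by (rule elts_set_of[OF small_doubleton])

lemma opair_inject: "opair a b = opair c d \<longleftrightarrow> a = c \<and> b = d"
proof
  assume "opair a b = opair c d"
  then have "{set_of {a, a}, set_of {a, b}} = {set_of {c, c}, set_of {c, d}}"
    unfolding opair_def by (simp add: set_of_inject[OF small_doubleton small_doubleton])
  then show "a = c \<and> b = d"
    unfolding doubleton_eq_iff set_of_inject[OF small_doubleton small_doubleton] by blast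
qed simp

lemma opair_components:
  assumes "transitive M" "opair a b \<in> M"
  shows "a \<in> M" "b \<in> M" "set_of {a} \<in> M" "set_of {a, b} \<in> M"
proof -
  have s: "elts (opair a b) \<subseteq> M" using assms unfolding transitive_def by blast
  then show 1: "set_of {a} \<in> M" "set_of {a, b} \<in> M" by (auto simp: elts_opair)
  have "elts (set_of {a, b}) \<subseteq> M" using assms(1) 1 unfolding transitive_def by blast
  then show "a \<in> M" "b \<in> M" by (auto simp: elts_set_of[OF small_doubleton])
qed

definition graph :: "('v \<Rightarrow> 'v) \<Rightarrow> 'v \<Rightarrow> 'v" where
  "graph F a = set_of ((\<lambda>u. opair u (F u)) ` elts a)"

lemma elts_graph: "elts (graph F a) = (\<lambda>u. opair u (F u)) ` elts a"
  unfolding graph_def by (rule elts_set_of[OF small_image[OF small_elts]])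

lemma function_on_graph: "function_on (graph F a) a"
  unfolding function_on_def elts_graph by (auto simp: opair_inject)

lemma app_eqI: "function_on f a \<Longrightarrow> u \<in> elts a \<Longrightarrow> opair u v \<in> elts f \<Longrightarrow> app f u = v"
  unfolding function_on_def app_def by (metis (mono_tags, lifting) the1_equality)

lemma opair_app: "function_on f a \<Longrightarrow> u \<in> elts a \<Longrightarrow> opair u (app f u) \<in> elts f"
  unfolding function_on_def app_def by (metis (mono_tags, lifting) theI')

lemma app_graph: "u \<in> elts a \<Longrightarrow> app (graph F a) u = F u"
  by (rule app_eqI[OF function_on_graph]) (auto simp: elts_graph)


section \<open>Well-foundedness of membership\<close>

lemma mem_irrefl: "x \<notin> elts x"
  using foundation[of "set_of {x}"] by (auto simp: elts_set_of[OF small_singleton])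

lemma infinite_set_exists: "\<exists>w. infinite (elts w)"
proof -
  obtain w where e: "\<exists>e\<in>elts w. elts e = {}"
    and suc: "\<forall>x\<in>elts w. \<exists>y\<in>elts w. elts y = insert x (elts x)"
    using infinity by blast
  obtain e where e: "e \<in> elts w" "elts e = {}" using e by blast
  obtain S where S: "\<And>x. x \<in> elts w \<Longrightarrow> S x \<in> elts w \<and> elts (S x) = insert x (elts x)"
    using suc by metis
  define s where "s n = (S ^^ n) e" for n :: nat
  have s_in: "s n \<in> elts w" for n
    by (induction n) (auto simp: s_def e(1) S)
  have elts_s: "elts (s n) = s ` {..<n}" for n
  proof (induction n)
    case 0 then show ?case by (simp add: s_def e(2))
  next
    case (Suc n)
    have "elts (s (Suc n)) = insert (s n) (elts (s n))" using S[OF s_in[of n]] by (simp add: s_def)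
    then show ?case using Suc by (simp add: lessThan_Suc)
  qed
  have "s m \<noteq> s n" if "m < n" for m n
    using elts_s[of n] that mem_irrefl by (metis imageI lessThan_iff)
  then have "inj s" by (metis injI nat_neq_iff)
  then have "infinite (range s)" by (rule range_inj_infinite)
  moreover have "range s \<subseteq> elts w" using s_in by blast
  ultimately show ?thesis using finite_subset by blast
qed

lemma small_range_nat: "small (range (F :: nat \<Rightarrow> 'v))"
proof -
  obtain w where "infinite (elts w)" using infinite_set_exists by blast
  then obtain g :: "nat \<Rightarrow> 'v" where g: "inj g" "range g \<subseteq> elts w"
    using infinite_countable_subset by blast
  have "range F = (F \<circ> inv g) ` range g" using g(1) by (auto simp: image_image)
  then show ?thesis using small_image[OF small_subset[OF small_elts g(2)]] by metis
qed

lemma small_trans_closure: "small (trans_closure x)"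
proof -
  define U where "U n = ((\<lambda>y. set_of (\<Union>z\<in>elts y. elts z)) ^^ n) x" for n :: nat
  have U: "elts (U (Suc n)) = (\<Union>z\<in>elts (U n). elts z)" for n
    unfolding U_def by (simp add: elts_set_of small_UN)
  have "\<exists>n. y \<in> elts (U n)" if "tranclp (\<lambda>u v. u \<in> elts v) y x" for y
    using that
  proof (induction rule: converse_tranclp_induct)
    case (base y)
    then have "y \<in> elts (U 0)" by (simp add: U_def)
    then show ?case ..
  next
    case (step y z) then show ?case using U by blast
  qed
  then have "trans_closure x \<subseteq> (\<Union>y\<in>range U. elts y)"
    unfolding trans_closure_def by blast
  then show ?thesis using small_subset[OF small_UN[OF small_range_nat]] small_elts by blast
qed

text \<open>
  Foundation speaks about sets only; a class is handled by cutting it down to the transitive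
  closure of one of its members.
\<close>

lemma wf_mem: "wf {(x, y). x \<in> elts y}"
proof (rule wfI_min)
  fix x Q assume "x \<in> (Q :: 'v set)"
  define T where "T = Q \<inter> ({x} \<union> trans_closure x)"
  have "small T"
    unfolding T_def by (rule small_subset[OF small_Un[OF small_singleton small_trans_closure]]) auto
  then have T: "elts (set_of T) = T" by (rule elts_set_of)
  have "x \<in> T" using \<open>x \<in> Q\<close> unfolding T_def by blast
  then obtain y where y: "y \<in> T" "elts y \<inter> T = {}" using foundation[of "set_of T"] T by auto
  have "z \<in> trans_closure x" if "z \<in> elts y" for z
    using y(1) that unfolding T_def trans_closure_def
    by (auto intro: tranclp_into_tranclp2)
  then have "z \<notin> Q" if "z \<in> elts y" for z using y(2) that unfolding T_def by blast
  then show "\<exists>z\<in>Q. \<forall>y. (y, z) \<in> {(x, y). x \<in> elts y} \<longrightarrow> y \<notin> Q"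
    using y(1) unfolding T_def by blast
qed

lemma mem_induct [case_names step]:
  "(\<And>x. (\<And>y. y \<in> elts x \<Longrightarrow> P y) \<Longrightarrow> P x) \<Longrightarrow> P a"
  using wf_induct[OF wf_mem, of P a] by blast

lemma mem_minimal:
  assumes "P x"
  obtains z where "P z" "\<And>y. y \<in> elts z \<Longrightarrow> \<not> P y"
  using wfE_min[OF wf_mem, of x "Collect P"] assms by auto

lemma mem_asym: "x \<in> elts y \<Longrightarrow> y \<notin> elts x"
  using wf_asym[OF wf_mem, of x y] by simp

lemma mem_no_3_cycle: "x \<in> elts y \<Longrightarrow> y \<in> elts z \<Longrightarrow> z \<notin> elts x"
  by (rule mem_minimal[of "\<lambda>t. t = x \<or> t = y \<or> t = z" x]) auto

lemma finite_has_mem_maximal: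
  assumes "finite S" "S \<noteq> {}"
  shows "\<exists>x\<in>S. \<forall>y\<in>S. x \<notin> elts y"
proof -
  let ?r = "{(x, y). x \<in> elts y} \<inter> S \<times> S"
  have "finite ?r" using assms(1) by auto
  moreover have "acyclic ?r" by (rule wf_acyclic[OF wf_subset[OF wf_mem]]) auto
  ultimately have "wf (?r\<inverse>)" by (rule finite_acyclic_wf_converse)
  moreover obtain a where "a \<in> S" using assms(2) by blast
  ultimately obtain x where x: "x \<in> S" "\<And>y. (y, x) \<in> ?r\<inverse> \<Longrightarrow> y \<notin> S" by (meson wfE_min)
  have "x \<notin> elts y" if "y \<in> S" for y using x(1) x(2)[of y] that by auto
  then show ?thesis using x(1) by blast
qed


section \<open>Ordinals and the existence of regular cardinals\<close>

lemma Ord_trans: "Ord \<alpha> \<Longrightarrow> x \<in> elts y \<Longrightarrow> y \<in> elts \<alpha> \<Longrightarrow> x \<in> elts \<alpha>"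
  unfolding Ord_def transitive_def by blast

lemma Ord_mem:
  assumes "Ord \<alpha>" "\<beta> \<in> elts \<alpha>"
  shows "Ord \<beta>"
proof -
  have sub: "elts \<beta> \<subseteq> elts \<alpha>" using assms Ord_trans by blast
  have "y \<in> elts \<beta>" if x: "x \<in> elts \<beta>" and y: "y \<in> elts x" for x y
  proof -
    have "y \<in> elts \<alpha>" using Ord_trans[OF assms(1)] x y sub by blast
    then have "y \<in> elts \<beta> \<or> y = \<beta> \<or> \<beta> \<in> elts y" using assms unfolding Ord_def by blast
    then show ?thesis using x y mem_asym mem_no_3_cycle by blast
  qed
  then show ?thesis using assms(1) sub unfolding Ord_def transitive_def by blast
qed

lemma Ord_psubset_imp_mem:
  assumes "Ord \<alpha>" "Ord \<beta>" "elts \<alpha> \<subset> elts \<beta>"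
  shows "\<alpha> \<in> elts \<beta>"
proof -
  obtain x where "x \<in> elts \<beta> \<and> x \<notin> elts \<alpha>" using assms(3) by blast
  then obtain \<gamma> where \<gamma>: "\<gamma> \<in> elts \<beta>" "\<gamma> \<notin> elts \<alpha>"
    and min: "\<And>y. y \<in> elts \<gamma> \<Longrightarrow> \<not> (y \<in> elts \<beta> \<and> y \<notin> elts \<alpha>)"
    using mem_minimal[of "\<lambda>x. x \<in> elts \<beta> \<and> x \<notin> elts \<alpha>"] by metis
  have "elts \<gamma> \<subseteq> elts \<alpha>" using min \<gamma>(1) Ord_trans[OF assms(2)] by blast
  moreover have "x \<in> elts \<gamma>" if "x \<in> elts \<alpha>" for x
  proof -
    have "x \<in> elts \<gamma> \<or> x = \<gamma> \<or> \<gamma> \<in> elts x"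
      using assms(2,3) that \<gamma>(1) unfolding Ord_def by blast
    then show ?thesis using that \<gamma>(2) Ord_trans[OF assms(1)] by blast
  qed
  ultimately have "\<gamma> = \<alpha>" by (intro extensionality) blast
  then show ?thesis using \<gamma>(1) by simp
qed

lemma Ord_trichotomy:
  assumes "Ord \<alpha>" "Ord \<beta>"
  shows "\<alpha> \<in> elts \<beta> \<or> \<alpha> = \<beta> \<or> \<beta> \<in> elts \<alpha>"
proof -
  let ?\<gamma> = "set_of (elts \<alpha> \<inter> elts \<beta>)"
  have \<gamma>: "elts ?\<gamma> = elts \<alpha> \<inter> elts \<beta>"
    by (rule elts_set_of[OF small_subset[OF small_elts[of \<alpha>]]]) blast
  have "Ord ?\<gamma>" using assms unfolding Ord_def transitive_def \<gamma> by blast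
  then have "elts \<alpha> \<inter> elts \<beta> = elts \<alpha> \<or> ?\<gamma> \<in> elts \<alpha>"
    and "elts \<alpha> \<inter> elts \<beta> = elts \<beta> \<or> ?\<gamma> \<in> elts \<beta>"
    using Ord_psubset_imp_mem assms \<gamma> by (metis inf_le1 psubsetI, metis inf_le2 psubsetI)
  moreover have "\<not> (?\<gamma> \<in> elts \<alpha> \<and> ?\<gamma> \<in> elts \<beta>)" using mem_irrefl[of ?\<gamma>] \<gamma> by blast
  ultimately have "elts \<alpha> \<subseteq> elts \<beta> \<or> elts \<beta> \<subseteq> elts \<alpha>" by blast
  then show ?thesis
    using Ord_psubset_imp_mem assms extensionality by (metis psubsetI)
qed

lemma Ord_set_of:
  assumes "small S" "transitive S" "\<And>x. x \<in> S \<Longrightarrow> Ord x"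
  shows "Ord (set_of S)"
  unfolding Ord_def elts_set_of[OF assms(1)] using assms(2,3) Ord_trichotomy by blast

text \<open>
  An ordinal is recovered from any copy of its ordering under an injection: by induction on
  membership, two ordinals with the same copy agree position by position.
\<close>

lemma Ord_order_copy_subset:
  fixes g g' :: "'v \<Rightarrow> 'b"
  defines "R \<equiv> (\<lambda>\<alpha> g. {(g u, g v) | u v. u \<in> elts \<alpha> \<and> v \<in> elts \<alpha> \<and> (u \<in> elts v \<or> u = v)})"
  assumes "Ord \<alpha>" "Ord \<alpha>'" "inj_on g (elts \<alpha>)" "inj_on g' (elts \<alpha>')" "R \<alpha> g = R \<alpha>' g'"
  shows "u \<in> elts \<alpha> \<longrightarrow> u \<in> elts \<alpha>' \<and> g u = g' u"
proof (induction u rule: mem_induct)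
  case (step u)
  show ?case
  proof
    assume u: "u \<in> elts \<alpha>"
    then have "(g u, g u) \<in> R \<alpha>' g'" using assms(6) unfolding R_def by blast
    then obtain w where w: "w \<in> elts \<alpha>'" "g' w = g u" unfolding R_def by auto
    have IH: "v \<in> elts \<alpha>' \<and> g v = g' v \<and> v \<in> elts \<alpha>" if "v \<in> elts u" for v
      using step that u Ord_trans[OF assms(2)] by blast
    have "elts u = elts w"
    proof (intro set_eqI iffI)
      fix v assume v: "v \<in> elts u"
      then have "(g v, g u) \<in> R \<alpha> g" using IH u unfolding R_def by blast
      then have "(g' v, g' w) \<in> R \<alpha>' g'" using assms(6) IH[OF v] w by simp
      then have "v \<in> elts w \<or> v = w"
        using IH[OF v] w(1) assms(5) unfolding R_def by (auto dest: inj_onD)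
      moreover have "v \<noteq> w"
        using IH[OF v] w u v assms(4) mem_irrefl by (metis inj_onD)
      ultimately show "v \<in> elts w" by blast
    next
      fix v assume v: "v \<in> elts w"
      then have v': "v \<in> elts \<alpha>'" using w(1) Ord_trans[OF assms(3)] by blast
      then have "(g' v, g' w) \<in> R \<alpha> g" using assms(6) w(1) v unfolding R_def by blast
      then obtain a b where ab: "a \<in> elts \<alpha>" "b \<in> elts \<alpha>" "g a = g' v" "g b = g u"
        "a \<in> elts b \<or> a = b" using w(2) unfolding R_def by auto
      then have b: "b = u" using u assms(4) by (meson inj_onD)
      have "a \<noteq> u" using ab(3) w v v' assms(5) mem_irrefl by (metis inj_onD)
      then have "a \<in> elts u" using ab(5) b by blast
      then show "v \<in> elts u" using IH ab(3) v' assms(5) by (metis inj_onD)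
    qed
    then have "u = w" by (rule extensionality)
    then show "u \<in> elts \<alpha>' \<and> g u = g' u" using w by simp
  qed
qed

text \<open>
  Hartogs: the ordinals that inject into an infinite set A form a set, because each of them
  is determined by a subset of A, namely by a copy of its ordering transported to A along an
  injection of A \<open>\<times>\<close> A into A.
\<close>

lemma small_Hartogs:
  includes cardinal_syntax
  assumes "small A" "infinite A"
  shows "small {\<alpha>. Ord \<alpha> \<and> elts \<alpha> \<lesssim> A}"
proof -
  define R where
    "R = (\<lambda>\<alpha> (g :: 'v \<Rightarrow> 'v). {(g u, g v) | u v. u \<in> elts \<alpha> \<and> v \<in> elts \<alpha> \<and> (u \<in> elts v \<or> u = v)})"
  have "|A \<times> A| \<le>o |A|" using card_of_Times_same_infinite[OF assms(2)] ordIso_imp_ordLeq by blast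
  then obtain p where p: "inj_on p (A \<times> A)" "p ` (A \<times> A) \<subseteq> A" unfolding card_of_ordLeq[symmetric] by blast
  define Q where "Q y \<alpha> \<longleftrightarrow> Ord \<alpha> \<and> (\<exists>g. inj_on g (elts \<alpha>) \<and> g ` elts \<alpha> \<subseteq> A \<and> elts y = p ` R \<alpha> g)"
    for y \<alpha>
  have uniq: "\<alpha> = \<alpha>'" if q: "Q y \<alpha>" "Q y \<alpha>'" for y \<alpha> \<alpha>'
  proof -
    obtain g where g: "Ord \<alpha>" "inj_on g (elts \<alpha>)" "g ` elts \<alpha> \<subseteq> A" "elts y = p ` R \<alpha> g"
      using q(1) unfolding Q_def by blast
    obtain g' where g': "Ord \<alpha>'" "inj_on g' (elts \<alpha>')" "g' ` elts \<alpha>' \<subseteq> A" "elts y = p ` R \<alpha>' g'"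
      using q(2) unfolding Q_def by blast
    have "R \<alpha> g \<subseteq> A \<times> A" "R \<alpha>' g' \<subseteq> A \<times> A" using g(3) g'(3) unfolding R_def by auto
    then have "R \<alpha> g = R \<alpha>' g'" using g(4) g'(4) p(1) by (metis inj_on_image_eq_iff)
    then have "elts \<alpha> = elts \<alpha>'"
      using Ord_order_copy_subset[OF g(1) g'(1) g(2) g'(2)]
        Ord_order_copy_subset[OF g'(1) g(1) g'(2) g(2)]
      unfolding R_def by blast
    then show ?thesis by (rule extensionality)
  qed
  have "{\<alpha>. Ord \<alpha> \<and> elts \<alpha> \<lesssim> A} \<subseteq> (\<lambda>y. SOME \<alpha>. Q y \<alpha>) ` {y. elts y \<subseteq> A}"
  proof
    fix \<alpha> assume "\<alpha> \<in> {\<alpha>. Ord \<alpha> \<and> elts \<alpha> \<lesssim> A}"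
    then obtain g where g: "Ord \<alpha>" "inj_on g (elts \<alpha>)" "g ` elts \<alpha> \<subseteq> A"
      unfolding lepoll_def by blast
    have "R \<alpha> g \<subseteq> A \<times> A" using g(3) unfolding R_def by auto
    then have sub: "p ` R \<alpha> g \<subseteq> A" using p(2) by blast
    define y where "y = set_of (p ` R \<alpha> g)"
    have y: "elts y = p ` R \<alpha> g"
      unfolding y_def by (rule elts_set_of[OF small_subset[OF assms(1) sub]])
    then have Q: "Q y \<alpha>" using g unfolding Q_def by blast
    have "(SOME \<alpha>. Q y \<alpha>) = \<alpha>" by (rule uniq[OF someI[of "Q y", OF Q] Q])
    then show "\<alpha> \<in> (\<lambda>y. SOME \<alpha>. Q y \<alpha>) ` {y. elts y \<subseteq> A}"
      by (rule image_eqI[OF sym]) (simp add: y sub)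
  qed
  then show ?thesis using small_subset[OF small_image[OF small_Pow[OF assms(1)]]] by blast
qed

lemma elts_omega: "elts omega = {n. Ord n \<and> finite (elts n)}"
proof -
  obtain w where w: "infinite (elts w)" using infinite_set_exists by blast
  have "{n. Ord n \<and> finite (elts n)} \<subseteq> {\<alpha>. Ord \<alpha> \<and> elts \<alpha> \<lesssim> elts w}"
    using w by (auto intro: finite_lepoll_infinite)
  then show ?thesis
    unfolding omega_def by (rule elts_set_of[OF small_subset[OF small_Hartogs[OF small_elts w]]])
qed

text \<open>
  The Hartogs number of an infinite set A is the successor cardinal of A. It is regular because
  a union of at most A many sets of size at most A has size at most A.
\<close>

lemma regular_above:
  includes cardinal_syntax
  assumes "small A" "infinite A"
  obtains \<theta> where "regular \<theta>" "A \<prec> elts \<theta>" "\<And>\<alpha>. Ord \<alpha> \<Longrightarrow> elts \<alpha> \<lesssim> A \<Longrightarrow> \<alpha> \<in> elts \<theta>"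
proof
  define \<theta> where "\<theta> = set_of {\<alpha>. Ord \<alpha> \<and> elts \<alpha> \<lesssim> A}"
  have \<theta>: "elts \<theta> = {\<alpha>. Ord \<alpha> \<and> elts \<alpha> \<lesssim> A}"
    unfolding \<theta>_def by (rule elts_set_of[OF small_Hartogs[OF assms]])
  have "transitive {\<alpha>. Ord \<alpha> \<and> elts \<alpha> \<lesssim> A}"
    unfolding transitive_def
  proof (intro ballI subsetI CollectI conjI; elim CollectE conjE)
    fix \<alpha> \<beta> assume \<beta>: "\<beta> \<in> elts \<alpha>" and \<alpha>: "Ord \<alpha>" "elts \<alpha> \<lesssim> A"
    show "Ord \<beta>" by (rule Ord_mem[OF \<alpha>(1) \<beta>])
    have "elts \<beta> \<subseteq> elts \<alpha>" using Ord_trans[OF \<alpha>(1) _ \<beta>] by blast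
    then show "elts \<beta> \<lesssim> A" using \<alpha>(2) by (meson subset_imp_lepoll lepoll_trans)
  qed
  then have Ord: "Ord \<theta>"
    unfolding \<theta>_def by (intro Ord_set_of small_Hartogs assms) auto
  have not: "\<not> elts \<theta> \<lesssim> A" using Ord \<theta> mem_irrefl[of \<theta>] by blast
  have "\<not> elts \<alpha> \<approx> elts \<theta>" if "\<alpha> \<in> elts \<theta>" for \<alpha>
    using that not \<theta> eqpoll_sym eqpoll_imp_lepoll lepoll_trans by blast
  then have Card: "Card \<theta>" using Ord unfolding Card_def by blast
  have inf: "infinite (elts \<theta>)" using not finite_lepoll_infinite[OF assms(2)] by blast
  have bound: "\<exists>\<beta>\<in>elts \<theta>. \<forall>\<xi>\<in>elts \<mu>. f \<xi> \<in> elts \<beta>" if \<mu>: "\<mu> \<in> elts \<theta>" and f: "f ` elts \<mu> \<subseteq> elts \<theta>" for \<mu> f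
  proof -
    define S where "S = (\<Union>\<xi>\<in>elts \<mu>. elts (f \<xi>)) \<union> f ` elts \<mu>"
    have S_small: "small S"
      unfolding S_def by (intro small_Un small_UN small_image) simp_all
    have S_sub: "S \<subseteq> elts \<theta>" using f Ord_trans[OF Ord] unfolding S_def by blast
    have "transitive S"
      unfolding transitive_def
    proof (intro ballI subsetI)
      fix x y assume "x \<in> S" and y: "y \<in> elts x"
      then obtain \<xi> where \<xi>: "\<xi> \<in> elts \<mu>" "x \<in> elts (f \<xi>) \<or> x = f \<xi>" unfolding S_def by blast
      then have "Ord (f \<xi>)" using f \<theta> by blast
      then have "y \<in> elts (f \<xi>)" using \<xi>(2) y Ord_trans by blast
      then show "y \<in> S" using \<xi>(1) unfolding S_def by blast
    qed
    then have "Ord (set_of S)" using S_small S_sub \<theta> by (intro Ord_set_of) auto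
    moreover have "S \<lesssim> A"
    proof -
      have le: "|elts \<alpha>| \<le>o |A|" if "\<alpha> \<in> elts \<theta>" for \<alpha>
        using that \<theta> unfolding lepoll_def card_of_ordLeq[symmetric] by blast
      have "|\<Union>\<xi>\<in>elts \<mu>. elts (f \<xi>)| \<le>o |A|"
        using card_of_UNION_ordLeq_infinite[OF assms(2) le[OF \<mu>], of "\<lambda>\<xi>. elts (f \<xi>)"] le f by blast
      moreover have "|f ` elts \<mu>| \<le>o |A|"
        using card_of_image le[OF \<mu>] ordLeq_transitive by blast
      ultimately have "|S| \<le>o |A|"
        unfolding S_def using card_of_Un_ordLeq_infinite_Field[of "|A|"] assms(2) card_of_Card_order
        by (metis Field_card_of)
      then show ?thesis unfolding lepoll_def card_of_ordLeq[symmetric] by blast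
    qed
    ultimately have "set_of S \<in> elts \<theta>" using \<theta> elts_set_of[OF S_small] by simp
    then show ?thesis using elts_set_of[OF S_small] unfolding S_def by blast
  qed
  show "regular \<theta>" unfolding regular_def using Card inf bound by blast
  have "A \<lesssim> elts \<theta>"
    using not ordLeq_total[OF card_of_Well_order card_of_Well_order, of A "elts \<theta>"]
    unfolding card_of_ordLeq[symmetric] lepoll_def by blast
  then show "A \<prec> elts \<theta>" using not unfolding lesspoll_def by (meson eqpoll_imp_lepoll eqpoll_sym)
  show "\<alpha> \<in> elts \<theta>" if "Ord \<alpha>" "elts \<alpha> \<lesssim> A" for \<alpha> using that \<theta> by blast
qed

lemma large_regular_exists:
  assumes "Ord \<alpha>"
  obtains \<theta> where "regular \<theta>" "\<alpha> \<in> elts \<theta>" "x \<in> H \<theta>"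
proof -
  obtain w where w: "infinite (elts w)" using infinite_set_exists by blast
  let ?A = "elts w \<union> (elts \<alpha> \<union> trans_closure x)"
  have "small ?A" by (intro small_Un small_elts small_trans_closure)
  moreover have "infinite ?A" using w by simp
  ultimately obtain \<theta> where \<theta>: "regular \<theta>" "?A \<prec> elts \<theta>"
    "\<And>\<alpha>. Ord \<alpha> \<Longrightarrow> elts \<alpha> \<lesssim> ?A \<Longrightarrow> \<alpha> \<in> elts \<theta>" using regular_above by metis
  have "\<alpha> \<in> elts \<theta>" by (rule \<theta>(3)[OF assms subset_imp_lepoll]) blast
  moreover have "trans_closure x \<prec> elts \<theta>"
    using \<theta>(2) subset_imp_lepoll[of "trans_closure x" ?A] lesspoll_trans1 by blast
  ultimately show ?thesis using that \<theta>(1) unfolding H_def by blast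
qed

lemma transitive_H: "transitive (H \<theta>)"
  unfolding transitive_def
proof (intro ballI subsetI)
  fix x y assume "x \<in> H \<theta>" and y: "y \<in> elts x"
  moreover have "trans_closure y \<subseteq> trans_closure x"
    unfolding trans_closure_def using y by (auto intro: tranclp.trancl_into_trancl)
  ultimately show "y \<in> H \<theta>"
    unfolding H_def using subset_imp_lepoll lesspoll_trans1 by blast
qed


section \<open>Formulas for pairs and function values\<close>

text \<open>
  The bound variables are numbered from 9 on, so the parameters of a formula may be any
  variables with smaller numbers.
\<close>

definition upair_fm :: "nat \<Rightarrow> nat \<Rightarrow> nat \<Rightarrow> fm" where
  "upair_fm z a b = FAnd (FMem a z) (FAnd (FMem b z)
     (FNeg (FEx 12 (FAnd (FMem 12 z) (FAnd (FNeg (FEq 12 a)) (FNeg (FEq 12 b)))))))"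

definition pair_fm :: "nat \<Rightarrow> nat \<Rightarrow> nat \<Rightarrow> fm" where
  "pair_fm p a b =
     FEx 10 (FEx 11 (FAnd (upair_fm 10 a a) (FAnd (upair_fm 11 a b) (upair_fm p 10 11))))"

definition app_fm :: "nat \<Rightarrow> nat \<Rightarrow> nat \<Rightarrow> fm" where
  "app_fm f a b = FEx 9 (FAnd (FMem 9 f) (pair_fm 9 a b))"

lemma sat_upair_fm:
  assumes "transitive M" "s z \<in> M" "z < 12" "a < 12" "b < 12"
  shows "sat M (upair_fm z a b) s \<longleftrightarrow> elts (s z) = {s a, s b}"
proof -
  have "elts (s z) \<subseteq> M" using assms(1,2) unfolding transitive_def by blast
  then show ?thesis using assms(3-5) by (auto simp: upair_fm_def)
qed

lemma sat_pair_fm: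
  assumes M: "transitive M" and "s p \<in> M" "p < 10" "a < 10" "b < 10"
  shows "sat M (pair_fm p a b) s \<longleftrightarrow> s p = opair (s a) (s b)"
proof -
  have "sat M (pair_fm p a b) s \<longleftrightarrow>
      (\<exists>q\<in>M. \<exists>r\<in>M. elts q = {s a} \<and> elts r = {s a, s b} \<and> elts (s p) = {q, r})"
    using assms unfolding pair_fm_def by (simp add: sat_upair_fm)
  also have "\<dots> \<longleftrightarrow> elts (s p) = {set_of {s a}, set_of {s a, s b}}"
  proof -
    have "elts (s p) \<subseteq> M" using assms(1,2) unfolding transitive_def by blast
    then show ?thesis by (auto simp flip: eq_set_of_iff[of "{s a}", OF small_singleton]
        eq_set_of_iff[of "{s a, s b}", OF small_doubleton])
  qed
  also have "\<dots> \<longleftrightarrow> s p = opair (s a) (s b)"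
    unfolding opair_def by (simp add: eq_set_of_iff[OF small_doubleton])
  finally show ?thesis .
qed

lemma sat_app_fm:
  assumes "transitive M" "s f \<in> M" "f < 9" "a < 9" "b < 9"
  shows "sat M (app_fm f a b) s \<longleftrightarrow> opair (s a) (s b) \<in> elts (s f)"
proof -
  have "elts (s f) \<subseteq> M" using assms(1,2) unfolding transitive_def by blast
  then show ?thesis using assms by (auto simp: app_fm_def sat_pair_fm)
qed

text \<open>Three parameters suffice for every formula to be transferred or used for separation.\<close>

definition env :: "'v \<Rightarrow> 'v \<Rightarrow> 'v \<Rightarrow> nat \<Rightarrow> 'v" where
  "env a b c i = (if i = 0 then a else if i = 1 then b else c)"

lemma env_simps [simp]:
  "env a b c 0 = a" "env a b c (Suc 0) = b" "env a b c 2 = c"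
  "(env a b c)(0 := z) = env z b c"
  by (auto simp: env_def fun_eq_iff)

lemma range_env: "a \<in> M \<Longrightarrow> b \<in> M \<Longrightarrow> c \<in> M \<Longrightarrow> range (env a b c) \<subseteq> M"
  by (auto simp: env_def)

lemma comp_env: "F \<circ> env a b c = env (F a) (F b) (F c)"
  by (auto simp: env_def fun_eq_iff)

end


section \<open>Transitive models of ZFC without power set\<close>

locale ZFC_minus_transitive_model = ZFC_universe elts for elts :: "'v \<Rightarrow> 'v set" +
  fixes N :: "'v set"
  assumes trans: "transitive N" and model: "ZFC_minus_model N"
begin

lemma mem_closed: "x \<in> N \<Longrightarrow> y \<in> elts x \<Longrightarrow> y \<in> N"
  using trans unfolding transitive_def by blast

lemma separation_closed:
  assumes "x \<in> N" "a \<in> N" "b \<in> N"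
  shows "set_of {z \<in> elts x. sat N \<phi> (env z a b)} \<in> N"
proof -
  have "\<forall>\<phi> s. range s \<subseteq> N \<longrightarrow>
      (\<forall>x\<in>N. \<exists>y\<in>N. \<forall>z\<in>N. z \<in> elts y \<longleftrightarrow> z \<in> elts x \<and> sat N \<phi> (s(0 := z)))"
    using model unfolding ZFC_minus_model_def by (elim conjE) assumption
  from this[rule_format, OF range_env[OF assms] assms(1), of \<phi>]
  obtain y where y: "y \<in> N" "\<forall>z\<in>N. z \<in> elts y \<longleftrightarrow> z \<in> elts x \<and> sat N \<phi> (env z a b)"
    by auto
  then have "elts y = {z \<in> elts x. sat N \<phi> (env z a b)}"
    using mem_closed assms(1) by blast
  then have "y = set_of {z \<in> elts x. sat N \<phi> (env z a b)}"
    by (metis eq_set_of_iff small_elts)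
  then show ?thesis using y(1) by simp
qed

lemma Int_closed:
  assumes "x \<in> N" "y \<in> N"
  shows "set_of (elts x \<inter> elts y) \<in> N"
  using separation_closed[OF assms(1) assms(2) assms(2), of "FMem 0 1"]
  by (simp add: Int_def)

lemma elts_set_of_Collect: "elts (set_of {z \<in> elts x. P z}) = {z \<in> elts x. P z}"
  by (rule elts_set_of[OF small_subset[OF small_elts[of x]]]) blast

lemma countable_in_subset:
  assumes "countable_in N x" "b \<in> N" "elts b \<subseteq> elts x"
  shows "countable_in N b"
proof -
  obtain f where f: "f \<in> N" "function_on f x" "\<forall>u\<in>elts x. app f u \<in> elts omega"
    "inj_on (app f) (elts x)"
    using assms(1) unfolding countable_in_def by blast
  let ?\<phi> = "FEx 3 (FAnd (FMem 3 1) (FEx 4 (pair_fm 0 3 4)))"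
  define g where "g = set_of {p \<in> elts f. sat N ?\<phi> (env p b b)}"
  have "g \<in> N" unfolding g_def by (rule separation_closed[OF f(1) assms(2) assms(2)])
  have sat: "sat N ?\<phi> (env p b b) \<longleftrightarrow> (\<exists>u\<in>elts b. \<exists>v. p = opair u v)" if "p \<in> elts f" for p
  proof -
    have p: "p \<in> N" using that f(1) mem_closed by blast
    then have "sat N ?\<phi> (env p b b) \<longleftrightarrow> (\<exists>u\<in>N. u \<in> elts b \<and> (\<exists>v\<in>N. p = opair u v))"
      by (simp add: sat_pair_fm trans)
    then show ?thesis using p opair_components[OF trans] by blast
  qed
  have g: "elts g = {p \<in> elts f. \<exists>u\<in>elts b. \<exists>v. p = opair u v}"
    unfolding g_def elts_set_of_Collect using sat by blast
  have "\<exists>!v. opair u v \<in> elts g" if "u \<in> elts b" for u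
  proof -
    have "\<exists>!v. opair u v \<in> elts f" using f(2) that assms(3) unfolding function_on_def by blast
    moreover have "opair u v \<in> elts g \<longleftrightarrow> opair u v \<in> elts f" for v using that g by blast
    ultimately show ?thesis by simp
  qed
  then have g_fun: "function_on g b" unfolding function_on_def using g by blast
  have app: "app g u = app f u" if "u \<in> elts b" for u
  proof (rule app_eqI[OF g_fun that])
    have "opair u (app f u) \<in> elts f" using opair_app[OF f(2)] that assms(3) by blast
    then show "opair u (app f u) \<in> elts g" using that g by blast
  qed
  have "inj_on (app g) (elts b)"
    using inj_on_subset[OF f(4) assms(3)] by (simp add: inj_on_def app)
  moreover have "\<forall>u\<in>elts b. app g u \<in> elts omega" using f(3) assms(3) app by auto
  ultimately show ?thesis unfolding countable_in_def using \<open>g \<in> N\<close> g_fun by blast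
qed

text \<open>
  A countable set of ordinals has a cofinal subset of order type at most \<open>\<omega>\<close>, namely the
  set of records of an enumeration: the members that exceed every member enumerated earlier.
\<close>

lemma countable_cofinal_records:
  assumes "a \<in> N" "countable_in N a" and Ord: "\<And>u. u \<in> elts a \<Longrightarrow> Ord u"
  obtains b where "b \<in> N" "elts b \<subseteq> elts a"
    "\<forall>u\<in>elts b. finite (elts b \<inter> elts u)"
    "\<forall>\<alpha>. Ord \<alpha> \<and> elts b \<subseteq> elts \<alpha> \<longrightarrow> elts a \<subseteq> elts \<alpha>"
proof -
  obtain f where f: "f \<in> N" "function_on f a" "\<forall>u\<in>elts a. app f u \<in> elts omega"
    "inj_on (app f) (elts a)"
    using assms(2) unfolding countable_in_def by blast
  let ?\<phi> = "FNeg (FEx 3 (FAnd (FMem 3 2) (FEx 4 (FEx 5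
      (FAnd (FAnd (app_fm 1 3 4) (app_fm 1 0 5)) (FAnd (FMem 4 5) (FNeg (FMem 3 0))))))))"
  define b where "b = set_of {u \<in> elts a. sat N ?\<phi> (env u f a)}"
  have "b \<in> N" unfolding b_def by (rule separation_closed[OF assms(1) f(1) assms(1)])
  have sat: "sat N ?\<phi> (env u f a) \<longleftrightarrow> (\<forall>v\<in>elts a. app f v \<in> elts (app f u) \<longrightarrow> v \<in> elts u)"
    if u: "u \<in> elts a" for u
  proof -
    have val: "opair v m \<in> elts f \<longleftrightarrow> m = app f v" if "v \<in> elts a" for v m
      using app_eqI[OF f(2) that] opair_app[OF f(2) that] by blast
    have val_N: "app f v \<in> N" if "v \<in> elts a" for v
      using opair_components(2)[OF trans mem_closed[OF f(1) opair_app[OF f(2) that]]] .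
    have "sat N ?\<phi> (env u f a) \<longleftrightarrow> \<not> (\<exists>v\<in>N. v \<in> elts a \<and> (\<exists>m\<in>N. \<exists>n\<in>N.
        (opair v m \<in> elts f \<and> opair u n \<in> elts f) \<and> m \<in> elts n \<and> v \<notin> elts u))"
      by (simp add: sat_app_fm trans f(1))
    also have "\<dots> \<longleftrightarrow> \<not> (\<exists>v\<in>elts a. app f v \<in> elts (app f u) \<and> v \<notin> elts u)"
      using val val_N u mem_closed[OF assms(1)] by (metis (no_types, lifting))
    finally show ?thesis by blast
  qed
  have b: "elts b = {u \<in> elts a. \<forall>v\<in>elts a. app f v \<in> elts (app f u) \<longrightarrow> v \<in> elts u}"
    unfolding b_def elts_set_of_Collect using sat by blast
  have fin: "finite (elts b \<inter> elts u)" if u: "u \<in> elts b" for u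
  proof -
    \<comment> \<open>The enumeration is increasing on the records, so the predecessors of a record inject
      into a natural number.\<close>
    have om: "Ord (app f v) \<and> finite (elts (app f v))" if "v \<in> elts b" for v
      using that f(3) b elts_omega by blast
    have "app f ` (elts b \<inter> elts u) \<subseteq> elts (app f u)"
    proof (intro image_subsetI, elim IntE)
      fix v assume v: "v \<in> elts b" "v \<in> elts u"
      then have "u \<notin> elts v" using mem_asym by blast
      then have "app f u \<notin> elts (app f v)" using v(1) u b by blast
      moreover have "app f v \<noteq> app f u"
        using f(4) u v b mem_irrefl[of u] by (metis (no_types, lifting) inj_onD mem_Collect_eq)
      ultimately show "app f v \<in> elts (app f u)"
        using Ord_trichotomy om u v(1) by metis
    qed
    moreover have "inj_on (app f) (elts b \<inter> elts u)" by (rule inj_on_subset[OF f(4)]) (use b in blast)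
    ultimately show ?thesis using om[OF u] inj_on_finite by blast
  qed
  have cofinal: "\<exists>v\<in>elts b. v \<notin> elts \<alpha>" if \<alpha>: "Ord \<alpha>" and u: "u \<in> elts a" "u \<notin> elts \<alpha>" for \<alpha> u
  proof -
    \<comment> \<open>The member enumerated first among those outside an ordinal is a record.\<close>
    have "\<exists>v\<in>elts a. v \<notin> elts \<alpha> \<and> app f u = app f v" using u by blast
    then obtain n where n: "\<exists>v\<in>elts a. v \<notin> elts \<alpha> \<and> n = app f v"
      and min: "\<And>m. m \<in> elts n \<Longrightarrow> \<not> (\<exists>v\<in>elts a. v \<notin> elts \<alpha> \<and> m = app f v)"
      using mem_minimal[of "\<lambda>n. \<exists>v\<in>elts a. v \<notin> elts \<alpha> \<and> n = app f v" "app f u"] by metis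
    obtain v where v: "v \<in> elts a" "v \<notin> elts \<alpha>" "n = app f v" using n by blast
    have "w \<in> elts v" if "w \<in> elts a" "app f w \<in> elts (app f v)" for w
    proof -
      have "w \<in> elts \<alpha>" using min that v(3) by blast
      moreover have "\<alpha> \<in> elts v \<or> \<alpha> = v" using Ord_trichotomy[OF \<alpha> Ord[OF v(1)]] v(2) by blast
      ultimately show ?thesis using Ord_trans[OF Ord[OF v(1)]] by blast
    qed
    then have "v \<in> elts b" using v(1) b by blast
    then show ?thesis using v(2) by blast
  qed
  show thesis
    by (rule that[OF \<open>b \<in> N\<close>]) (use b fin cofinal in blast)+
qed

end


section \<open>Small embeddings\<close>

locale small_embedding_universe = ZFC_universe elts for elts :: "'v \<Rightarrow> 'v set" +
  fixes \<kappa> \<theta> M :: 'v and j :: "'v \<Rightarrow> 'v"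
  assumes emb: "small_embedding \<kappa> \<theta> M j"
begin

abbreviation \<delta> :: 'v where "\<delta> \<equiv> crit j (elts M)"

lemma trans_M: "transitive (elts M)"
  using emb unfolding small_embedding_def by blast

lemma mem_M: "x \<in> elts M \<Longrightarrow> y \<in> elts x \<Longrightarrow> y \<in> elts M"
  using trans_M unfolding transitive_def by blast

lemma mem_H: "x \<in> H \<theta> \<Longrightarrow> y \<in> elts x \<Longrightarrow> y \<in> H \<theta>"
  using transitive_H unfolding transitive_def by blast

lemma j_in_H: "x \<in> elts M \<Longrightarrow> j x \<in> H \<theta>"
  using emb unfolding small_embedding_def elementary_embedding_def by blast

lemma elementarity:
  assumes "a \<in> elts M" "b \<in> elts M" "c \<in> elts M"
  shows "sat (elts M) \<phi> (env a b c) \<longleftrightarrow> sat (H \<theta>) \<phi> (env (j a) (j b) (j c))"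
  using emb range_env[OF assms]
  unfolding small_embedding_def elementary_embedding_def comp_env[symmetric] by blast

lemma j_mem_iff: "x \<in> elts M \<Longrightarrow> y \<in> elts M \<Longrightarrow> j x \<in> elts (j y) \<longleftrightarrow> x \<in> elts y"
  using elementarity[of x y y "FMem 0 1"] by simp

lemma j_opair_iff:
  assumes "f \<in> elts M" "a \<in> elts M" "b \<in> elts M"
  shows "opair (j a) (j b) \<in> elts (j f) \<longleftrightarrow> opair a b \<in> elts f"
  using elementarity[OF assms, of "app_fm 0 1 2"]
  by (simp add: sat_app_fm trans_M transitive_H assms j_in_H)

lemma crit_properties:
  shows crit_in_M: "\<delta> \<in> elts M" and Ord_crit: "Ord \<delta>" and crit_moved: "\<delta> \<in> elts (j \<delta>)"
    and crit_least: "\<And>\<beta>. \<beta> \<in> elts M \<Longrightarrow> Ord \<beta> \<Longrightarrow> \<beta> \<in> elts (j \<beta>) \<Longrightarrow> \<delta> = \<beta> \<or> \<delta> \<in> elts \<beta>"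
proof -
  define P where "P \<alpha> \<longleftrightarrow> \<alpha> \<in> elts M \<and> Ord \<alpha> \<and> \<alpha> \<in> elts (j \<alpha>)" for \<alpha>
  have "\<exists>\<alpha>. P \<alpha>" using emb unfolding small_embedding_def nontrivial_def P_def by blast
  then obtain \<alpha> where \<alpha>: "P \<alpha>" and min: "\<And>\<beta>. \<beta> \<in> elts \<alpha> \<Longrightarrow> \<not> P \<beta>"
    using mem_minimal[of P] by metis
  have least: "\<alpha> = \<beta> \<or> \<alpha> \<in> elts \<beta>" if "P \<beta>" for \<beta>
    using Ord_trichotomy[of \<alpha> \<beta>] \<alpha> min that unfolding P_def by blast
  have "\<delta> = \<alpha>"
    unfolding crit_def
  proof (rule the_equality)
    show "\<alpha> \<in> elts M \<and> Ord \<alpha> \<and> \<alpha> \<in> elts (j \<alpha>) \<and>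
        (\<forall>\<beta>\<in>elts M. Ord \<beta> \<and> \<beta> \<in> elts (j \<beta>) \<longrightarrow> \<alpha> = \<beta> \<or> \<alpha> \<in> elts \<beta>)"
      using \<alpha> least unfolding P_def by blast
  next
    fix \<beta> assume \<beta>: "\<beta> \<in> elts M \<and> Ord \<beta> \<and> \<beta> \<in> elts (j \<beta>) \<and>
        (\<forall>\<gamma>\<in>elts M. Ord \<gamma> \<and> \<gamma> \<in> elts (j \<gamma>) \<longrightarrow> \<beta> = \<gamma> \<or> \<beta> \<in> elts \<gamma>)"
    then have "P \<beta>" unfolding P_def by blast
    moreover have "\<beta> = \<alpha> \<or> \<beta> \<in> elts \<alpha>" using \<beta> \<alpha> unfolding P_def by blast
    ultimately show "\<beta> = \<alpha>" using min by blast
  qed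
  then show "\<delta> \<in> elts M" "Ord \<delta>" "\<delta> \<in> elts (j \<delta>)"
    "\<And>\<beta>. \<beta> \<in> elts M \<Longrightarrow> Ord \<beta> \<Longrightarrow> \<beta> \<in> elts (j \<beta>) \<Longrightarrow> \<delta> = \<beta> \<or> \<delta> \<in> elts \<beta>"
    using \<alpha> least unfolding P_def by blast+
qed

lemma j_crit: "j \<delta> = \<kappa>"
  using emb unfolding small_embedding_def by blast

lemma Card_kappa: "Card \<kappa>" and Ord_kappa: "Ord \<kappa>"
  using emb unfolding small_embedding_def Card_def by blast+

lemma crit_less: "\<delta> \<in> elts \<kappa>"
  using crit_moved j_crit by simp

lemma crit_subset: "elts \<delta> \<subseteq> elts \<kappa>"
  using Ord_trans[OF Ord_kappa _ crit_less] by blast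

lemma crit_in_H: "\<delta> \<in> H \<theta>" and kappa_in_H: "\<kappa> \<in> H \<theta>"
  using mem_H[OF j_in_H[OF crit_in_M] crit_moved] j_in_H[OF crit_in_M] j_crit by auto

lemma j_fixes_below_crit: "\<beta> \<in> elts \<delta> \<longrightarrow> j \<beta> = \<beta>"
proof (induction \<beta> rule: mem_induct)
  case (step \<beta>)
  show ?case
  proof
    assume \<beta>: "\<beta> \<in> elts \<delta>"
    then have M: "\<beta> \<in> elts M" and O: "Ord \<beta>" using mem_M crit_in_M Ord_mem[OF Ord_crit] by blast+
    have "j \<beta> \<in> elts \<kappa>" using j_mem_iff[OF M crit_in_M] \<beta> j_crit by simp
    then have O': "Ord (j \<beta>)" by (rule Ord_mem[OF Ord_kappa])
    have "\<beta> \<notin> elts (j \<beta>)" using crit_least[OF M O] \<beta> mem_irrefl mem_asym by blast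
    moreover have "j \<beta> \<notin> elts \<beta>"
    proof
      assume less: "j \<beta> \<in> elts \<beta>"
      then have "j (j \<beta>) = j \<beta>" using step Ord_trans[OF Ord_crit less \<beta>] by blast
      moreover have "j (j \<beta>) \<in> elts (j \<beta>)" using j_mem_iff[OF mem_M[OF M less] M] less by simp
      ultimately show False using mem_irrefl by metis
    qed
    ultimately show "j \<beta> = \<beta>" using Ord_trichotomy[OF O O'] by auto
  qed
qed

lemmas j_fixes = j_fixes_below_crit[rule_format]

lemma below_crit_in_M: "\<beta> \<in> elts \<delta> \<Longrightarrow> \<beta> \<in> elts M"
  using mem_M[OF crit_in_M] .

text \<open>
  The embedding carries a statement about \<open>\<delta>\<close> and ordinals below it to the same statement about
  \<open>\<kappa>\<close>, where \<open>\<delta>\<close> itself may serve as the witness for an existential quantifier.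
\<close>

lemma Limit_crit: "Limit \<delta>"
  unfolding Limit_def
proof (intro conjI ballI)
  show "Ord \<delta>" by (rule Ord_crit)
  have "(\<exists>y\<in>elts M. y \<in> elts \<delta>) \<longleftrightarrow> (\<exists>y\<in>H \<theta>. y \<in> elts \<kappa>)"
    using elementarity[OF crit_in_M crit_in_M crit_in_M, of "FEx 3 (FMem 3 0)"] j_crit by simp
  then show "elts \<delta> \<noteq> {}" using crit_in_H crit_less by blast
next
  fix \<alpha> assume \<alpha>: "\<alpha> \<in> elts \<delta>"
  have "(\<exists>y\<in>elts M. y \<in> elts \<delta> \<and> \<alpha> \<in> elts y) \<longleftrightarrow> (\<exists>y\<in>H \<theta>. y \<in> elts \<kappa> \<and> \<alpha> \<in> elts y)"
    using elementarity[OF crit_in_M below_crit_in_M[OF \<alpha>] crit_in_M,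
        of "FEx 3 (FAnd (FMem 3 0) (FMem 1 3))"] j_crit j_fixes[OF \<alpha>] by simp
  then show "\<exists>\<beta>\<in>elts \<delta>. \<alpha> \<in> elts \<beta>" using crit_in_H crit_less \<alpha> by blast
qed

lemma crit_infinite: "infinite (elts \<delta>)"
proof
  assume "finite (elts \<delta>)"
  moreover have "elts \<delta> \<noteq> {}" using Limit_crit unfolding Limit_def by blast
  ultimately show False
    using finite_has_mem_maximal[of "elts \<delta>"] Limit_crit unfolding Limit_def by blast
qed

lemma crit_in_club:
  assumes "C \<in> elts M" "club (j C) \<kappa>"
  shows "unbounded_in (j C) \<delta>" "\<delta> \<in> elts (j C)"
proof -
  show unb: "unbounded_in (j C) \<delta>"
    unfolding unbounded_in_def
  proof
    fix \<alpha> assume \<alpha>: "\<alpha> \<in> elts \<delta>"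
    let ?\<phi> = "FEx 3 (FAnd (FAnd (FMem 3 0) (FMem 3 1)) (FNeg (FAnd (FNeg (FEq 2 3)) (FNeg (FMem 2 3)))))"
    have "\<alpha> \<in> elts \<kappa>" using \<alpha> crit_subset by blast
    then obtain \<beta> where "\<beta> \<in> elts (j C) \<inter> elts \<kappa>" "\<alpha> = \<beta> \<or> \<alpha> \<in> elts \<beta>"
      using assms(2) unfolding club_def unbounded_in_def by blast
    then have "sat (H \<theta>) ?\<phi> (env (j C) \<kappa> \<alpha>)" using mem_H[OF kappa_in_H] by auto
    then have "sat (elts M) ?\<phi> (env C \<delta> \<alpha>)"
      using elementarity[OF assms(1) crit_in_M below_crit_in_M[OF \<alpha>], of ?\<phi>] j_crit j_fixes[OF \<alpha>]
      by simp
    then obtain \<beta> where \<beta>: "\<beta> \<in> elts C" "\<beta> \<in> elts \<delta>" "\<alpha> = \<beta> \<or> \<alpha> \<in> elts \<beta>" by auto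
    then have "\<beta> \<in> elts (j C)"
      using j_mem_iff[OF below_crit_in_M[OF \<beta>(2)] assms(1)] j_fixes[OF \<beta>(2)] by simp
    then show "\<exists>\<beta>\<in>elts (j C) \<inter> elts \<delta>. \<alpha> = \<beta> \<or> \<alpha> \<in> elts \<beta>" using \<beta> by blast
  qed
  show "\<delta> \<in> elts (j C)" using assms(2) unb Limit_crit crit_less unfolding club_def by blast
qed

lemma app_below_crit:
  assumes "f \<in> elts M" "function_on (j f) a" "\<xi> \<in> elts a" "\<xi> \<in> elts \<delta>"
  obtains y where "y \<in> elts M" "j y = app (j f) \<xi>"
proof -
  have \<xi>: "\<xi> \<in> elts M" "j \<xi> = \<xi>" using below_crit_in_M j_fixes assms(4) by blast+
  let ?\<phi> = "FEx 3 (app_fm 1 0 3)"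
  have val: "opair \<xi> (app (j f) \<xi>) \<in> elts (j f)" by (rule opair_app[OF assms(2,3)])
  then have "app (j f) \<xi> \<in> H \<theta>"
    using opair_components(2)[OF transitive_H mem_H[OF j_in_H[OF assms(1)]]] by blast
  then have "sat (H \<theta>) ?\<phi> (env (j \<xi>) (j f) (j f))"
    using val \<xi> by (auto simp: sat_app_fm transitive_H j_in_H assms(1))
  then have "sat (elts M) ?\<phi> (env \<xi> f f)" using elementarity[OF \<xi>(1) assms(1) assms(1)] by blast
  then obtain y where y: "y \<in> elts M" "opair \<xi> y \<in> elts f"
    by (auto simp: sat_app_fm trans_M assms(1))
  then have "opair \<xi> (j y) \<in> elts (j f)" using j_opair_iff[OF assms(1) \<xi>(1) y(1)] \<xi>(2) by simp
  then have "app (j f) \<xi> = j y" by (rule app_eqI[OF assms(2,3)])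
  then show thesis using that y(1) by simp
qed

lemma j_fixes_bounded_subsets:
  assumes "y \<in> elts M" "\<beta> \<in> elts \<delta>" "elts (j y) \<subseteq> elts \<beta>"
  shows "j y = y"
proof (rule extensionality, intro set_eqI iffI)
  have below: "u \<in> elts \<delta>" if "u \<in> elts \<beta>" for u
    using Ord_trans[OF Ord_crit that assms(2)] .
  fix u
  show "u \<in> elts y" if "u \<in> elts (j y)"
  proof -
    have "u \<in> elts \<delta>" using that assms(3) below by blast
    then show ?thesis using j_mem_iff[OF below_crit_in_M assms(1)] j_fixes that by metis
  qed
  show "u \<in> elts (j y)" if "u \<in> elts y"
  proof -
    have u: "u \<in> elts M" using mem_M[OF assms(1) that] .
    then have ju: "j u \<in> elts (j y)" using j_mem_iff[OF u assms(1)] that by simp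
    then have "j u \<in> elts (j \<beta>)" using assms(2,3) j_fixes by auto
    then have "u \<in> elts \<beta>" using j_mem_iff[OF u below_crit_in_M[OF assms(2)]] by simp
    then have "j u = u" using below j_fixes by blast
    then show ?thesis using ju by simp
  qed
qed

text \<open>
  If \<open>b\<close> is cofinal in \<open>\<delta>\<close>, then \<open>\<delta>\<close> is a limit point of \<open>j b\<close> below \<open>\<kappa>\<close>, because \<open>j b\<close>
  contains \<open>b\<close>. By elementarity \<open>b\<close> has a limit point below \<open>\<delta>\<close>.
\<close>

lemma cofinal_has_limit_point:
  assumes "b \<in> elts M" "elts b \<subseteq> elts \<delta>" and unb: "\<And>\<alpha>. \<alpha> \<in> elts \<delta> \<Longrightarrow> \<exists>u\<in>elts b. u \<notin> elts \<alpha>"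
  obtains \<gamma> where "\<gamma> \<in> elts \<delta>" "elts \<gamma> \<noteq> {}"
    "\<forall>\<alpha>\<in>elts \<gamma>. \<exists>u\<in>elts b \<inter> elts \<gamma>. \<alpha> \<in> elts u"
proof -
  let ?\<phi> = "FEx 3 (FAnd (FMem 3 1) (FAnd (FEx 4 (FMem 4 3))
      (FNeg (FEx 4 (FAnd (FMem 4 3) (FNeg (FEx 5 (FAnd (FMem 5 0) (FAnd (FMem 5 3) (FMem 4 5))))))))))"
  have sat: "sat K ?\<phi> (env c \<epsilon> \<epsilon>) \<longleftrightarrow> (\<exists>\<gamma>\<in>K. \<gamma> \<in> elts \<epsilon> \<and> (\<exists>\<alpha>\<in>K. \<alpha> \<in> elts \<gamma>) \<and>
      (\<forall>\<alpha>\<in>K. \<alpha> \<in> elts \<gamma> \<longrightarrow> (\<exists>u\<in>K. u \<in> elts c \<and> u \<in> elts \<gamma> \<and> \<alpha> \<in> elts u)))" for K c \<epsilon>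
    by simp blast
  have "\<exists>u\<in>H \<theta>. u \<in> elts (j b) \<and> u \<in> elts \<delta> \<and> \<alpha> \<in> elts u" if \<alpha>: "\<alpha> \<in> elts \<delta>" for \<alpha>
  proof -
    obtain \<alpha>' where \<alpha>': "\<alpha>' \<in> elts \<delta>" "\<alpha> \<in> elts \<alpha>'" using Limit_crit \<alpha> unfolding Limit_def by blast
    obtain u where u: "u \<in> elts b" "u \<notin> elts \<alpha>'" using unb[OF \<alpha>'(1)] by blast
    have u\<delta>: "u \<in> elts \<delta>" using u(1) assms(2) by blast
    have Ou: "Ord u" using Ord_mem[OF Ord_crit u\<delta>] .
    then have "\<alpha>' = u \<or> \<alpha>' \<in> elts u" using Ord_trichotomy[OF Ord_mem[OF Ord_crit \<alpha>'(1)] Ou] u(2) by blast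
    then have "\<alpha> \<in> elts u" using \<alpha>'(2) Ord_trans[OF Ou] by blast
    moreover have "u \<in> elts (j b)"
      using j_mem_iff[OF below_crit_in_M[OF u\<delta>] assms(1)] j_fixes[OF u\<delta>] u(1) by simp
    moreover have "u \<in> H \<theta>" using mem_H[OF crit_in_H u\<delta>] .
    ultimately show ?thesis using u\<delta> by blast
  qed
  moreover have "\<exists>\<alpha>\<in>H \<theta>. \<alpha> \<in> elts \<delta>" using Limit_crit mem_H[OF crit_in_H] unfolding Limit_def by blast
  ultimately have "sat (H \<theta>) ?\<phi> (env (j b) \<kappa> \<kappa>)"
    unfolding sat using crit_in_H crit_less by blast
  then have "sat (elts M) ?\<phi> (env b \<delta> \<delta>)"
    using elementarity[OF assms(1) crit_in_M crit_in_M, of ?\<phi>] j_crit by metis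
  then obtain \<gamma> where \<gamma>: "\<gamma> \<in> elts M" "\<gamma> \<in> elts \<delta>" "\<exists>\<alpha>\<in>elts M. \<alpha> \<in> elts \<gamma>"
    "\<forall>\<alpha>\<in>elts M. \<alpha> \<in> elts \<gamma> \<longrightarrow> (\<exists>u\<in>elts M. u \<in> elts b \<and> u \<in> elts \<gamma> \<and> \<alpha> \<in> elts u)"
    unfolding sat by blast
  show thesis
  proof
    show "\<gamma> \<in> elts \<delta>" "elts \<gamma> \<noteq> {}" using \<gamma> by auto
    show "\<forall>\<alpha>\<in>elts \<gamma>. \<exists>u\<in>elts b \<inter> elts \<gamma>. \<alpha> \<in> elts u"
      using \<gamma>(4) mem_M[OF \<gamma>(1)] by blast
  qed
qed

end


section \<open>Internal models containing the countable subsets of the critical point\<close>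

locale internal_small_embedding =
  small_embedding_universe elts \<kappa> \<theta> M j + ZFC_minus_transitive_model elts "elts N"
  for elts :: "'v \<Rightarrow> 'v set" and \<kappa> \<theta> M :: 'v and j :: "'v \<Rightarrow> 'v" and N :: 'v +
  assumes M_in_N: "M \<in> elts N"
    and countable_subsets:
      "{a \<in> elts N. elts a \<subseteq> elts (crit j (elts M)) \<and> countable_in (elts N) a} \<subseteq> elts M"
begin

text \<open>
  A counterexample would have a cofinal subset of order type \<open>\<omega>\<close> in N. This subset is countable
  in N, hence belongs to M, and has no limit point below \<open>\<delta>\<close>, against the
  reflection of limit points.
\<close>

lemma countable_subset_bounded:
  assumes "a \<in> elts N" "elts a \<subseteq> elts \<delta>" "countable_in (elts N) a"
  shows "\<exists>\<alpha>\<in>elts \<delta>. elts a \<subseteq> elts \<alpha>"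
proof (rule ccontr)
  assume neg: "\<not> (\<exists>\<alpha>\<in>elts \<delta>. elts a \<subseteq> elts \<alpha>)"
  have Ord: "Ord u" if "u \<in> elts \<delta>" for u using Ord_mem[OF Ord_crit that] .
  have Ord_a: "Ord u" if "u \<in> elts a" for u using Ord assms(2) that by blast
  obtain b where b: "b \<in> elts N" "elts b \<subseteq> elts a"
    and fin: "\<forall>u\<in>elts b. finite (elts b \<inter> elts u)"
    and cof: "\<forall>\<alpha>. Ord \<alpha> \<and> elts b \<subseteq> elts \<alpha> \<longrightarrow> elts a \<subseteq> elts \<alpha>"
    by (rule countable_cofinal_records[OF assms(1,3) Ord_a])
  have b\<delta>: "elts b \<subseteq> elts \<delta>" using b(2) assms(2) by blast
  have "countable_in (elts N) b" by (rule countable_in_subset[OF assms(3) b])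
  then have bM: "b \<in> elts M" using b(1) b\<delta> countable_subsets by blast
  have unb: "\<exists>u\<in>elts b. u \<notin> elts \<alpha>" if "\<alpha> \<in> elts \<delta>" for \<alpha>
    using neg that cof Ord[OF that] by blast
  obtain \<gamma> where \<gamma>: "\<gamma> \<in> elts \<delta>" "elts \<gamma> \<noteq> {}"
    and lim: "\<forall>\<alpha>\<in>elts \<gamma>. \<exists>u\<in>elts b \<inter> elts \<gamma>. \<alpha> \<in> elts u"
    by (rule cofinal_has_limit_point[OF bM b\<delta> unb])
  obtain u where u: "u \<in> elts b" "u \<notin> elts \<gamma>" using unb[OF \<gamma>(1)] by blast
  have Ou: "Ord u" using u(1) b\<delta> Ord by blast
  then have "\<gamma> = u \<or> \<gamma> \<in> elts u" using Ord_trichotomy[OF Ord[OF \<gamma>(1)]] u(2) by blast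
  then have "elts \<gamma> \<subseteq> elts u" using Ord_trans[OF Ou] by blast
  then have "finite (elts b \<inter> elts \<gamma>)" using bspec[OF fin u(1)] by (meson Int_mono finite_subset order_refl)
  moreover have "elts b \<inter> elts \<gamma> \<noteq> {}" using \<gamma>(2) lim by blast
  ultimately obtain x where "x \<in> elts b \<inter> elts \<gamma>" "\<forall>y\<in>elts b \<inter> elts \<gamma>. x \<notin> elts y"
    using finite_has_mem_maximal by blast
  then show False using lim by blast
qed

text \<open>
  A trace of \<open>d\<close> at \<open>\<delta>\<close> on a countable set of N is bounded below \<open>\<delta>\<close>, so by slenderness it
  is a trace of some \<open>d\<close> at \<open>\<beta>\<close> with \<open>\<beta> < \<delta>\<close>. The latter set is its own preimage
  under the embedding and lies in \<open>M \<subseteq> N\<close>. The approximation property then applies.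
\<close>

lemma slender_value_in_model:
  assumes approx: "omega1_approximation (elts N) (H \<theta>)"
    and d: "d \<in> elts M" "kappa_list \<kappa> (j d)"
    and slender: "\<And>\<alpha>. \<alpha> \<in> elts \<delta> \<Longrightarrow>
      \<exists>\<beta>\<in>elts \<delta>. elts (app (j d) \<delta>) \<inter> elts \<alpha> = elts (app (j d) \<beta>) \<inter> elts \<alpha>"
  shows "app (j d) \<delta> \<in> elts N"
proof -
  let ?A = "app (j d) \<delta>"
  have fd: "function_on (j d) \<kappa>" using d(2) unfolding kappa_list_def by blast
  have A_sub: "elts ?A \<subseteq> elts \<delta>" using d(2) crit_less unfolding kappa_list_def by blast
  have A_H: "?A \<in> H \<theta>"
    using opair_components(2)[OF transitive_H mem_H[OF j_in_H[OF d(1)] opair_app[OF fd crit_less]]] .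
  have M_sub_N: "x \<in> elts N" if "x \<in> elts M" for x using mem_closed[OF M_in_N that] .
  have \<delta>N: "\<delta> \<in> elts N" using M_sub_N[OF crit_in_M] .
  have trace: "set_of (elts ?A \<inter> elts x) \<in> elts N" if x: "x \<in> elts N" "countable_in (elts N) x" for x
  proof -
    define a where "a = set_of (elts x \<inter> elts \<delta>)"
    have a: "elts a = elts x \<inter> elts \<delta>"
      unfolding a_def by (rule elts_set_of[OF small_subset[OF small_elts[of x]]]) blast
    have aN: "a \<in> elts N" unfolding a_def by (rule Int_closed[OF x(1) \<delta>N])
    have "countable_in (elts N) a" by (rule countable_in_subset[OF x(2) aN]) (use a in blast)
    then obtain \<alpha> where \<alpha>: "\<alpha> \<in> elts \<delta>" "elts a \<subseteq> elts \<alpha>"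
      using countable_subset_bounded[OF aN] a by blast
    obtain \<beta> where \<beta>: "\<beta> \<in> elts \<delta>" "elts ?A \<inter> elts \<alpha> = elts (app (j d) \<beta>) \<inter> elts \<alpha>"
      using slender[OF \<alpha>(1)] by blast
    have \<beta>\<kappa>: "\<beta> \<in> elts \<kappa>" using \<beta>(1) crit_subset by blast
    obtain y where y: "y \<in> elts M" "j y = app (j d) \<beta>"
      using app_below_crit[OF d(1) fd \<beta>\<kappa> \<beta>(1)] by blast
    have "elts (j y) \<subseteq> elts \<beta>" using d(2) \<beta>\<kappa> y(2) unfolding kappa_list_def by simp
    then have "j y = y" by (rule j_fixes_bounded_subsets[OF y(1) \<beta>(1)])
    then have "app (j d) \<beta> \<in> elts N" using M_sub_N[OF y(1)] y(2) by simp
    moreover have "elts ?A \<inter> elts x = elts (app (j d) \<beta>) \<inter> elts a"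
      using A_sub a \<alpha>(2) \<beta>(2) by blast
    ultimately show ?thesis using Int_closed[OF _ aN] by simp
  qed
  show ?thesis using approx A_H A_sub \<delta>N trace unfolding omega1_approximation_def by blast
qed

end


section \<open>The slender subtle property\<close>

context ZFC_universe
begin

lemma internally_AP_subtle_embedding:
  assumes "internally_AP_subtle \<kappa>" "club C \<kappa>" "kappa_list \<kappa> d"
  obtains \<theta> M j N where
    "internal_small_embedding elts \<kappa> \<theta> M j N"
    "{x, d, C} \<subseteq> j ` elts M"
    "omega1_approximation (elts N) (H \<theta>)"
    "app d (crit j (elts M)) \<in> elts N \<longrightarrow> (\<exists>\<alpha>\<in>elts (crit j (elts M)). \<alpha> \<in> elts C \<and>
       elts (app d \<alpha>) = elts (app d (crit j (elts M))) \<inter> elts \<alpha>)"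
proof -
  define E where "E \<theta> x C d \<longleftrightarrow> (\<exists>M j N. small_embedding \<kappa> \<theta> M j \<and>
      transitive (elts N) \<and> ZFC_minus_model (elts N) \<and>
      {x, d, C} \<subseteq> j ` elts M \<and>
      (elts N \<subseteq> H \<theta> \<and> omega1_approximation (elts N) (H \<theta>)) \<and>
      (M \<in> elts N \<and>
       {a \<in> elts N. elts a \<subseteq> elts (crit j (elts M)) \<and> countable_in (elts N) a} \<subseteq> elts M) \<and>
      (app d (crit j (elts M)) \<in> elts N \<longrightarrow>
        (\<exists>\<alpha>\<in>elts (crit j (elts M)). \<alpha> \<in> elts C \<and>
           elts (app d \<alpha>) = elts (app d (crit j (elts M))) \<inter> elts \<alpha>)))" for \<theta> x C d
  have "\<exists>\<alpha>0. Ord \<alpha>0 \<and> (\<alpha>0 = \<kappa> \<or> \<kappa> \<in> elts \<alpha>0) \<and>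
      (\<forall>\<theta>. regular \<theta> \<and> \<alpha>0 \<in> elts \<theta> \<longrightarrow>
        (\<forall>x\<in>H \<theta>. \<forall>C d. club C \<kappa> \<and> kappa_list \<kappa> d \<longrightarrow> E \<theta> x C d))"
    unfolding E_def by (rule conjunct2[OF assms(1)[unfolded internally_AP_subtle_def]])
  then obtain \<alpha>0 where \<alpha>0: "Ord \<alpha>0" and embs: "\<forall>\<theta>. regular \<theta> \<and> \<alpha>0 \<in> elts \<theta> \<longrightarrow>
      (\<forall>x\<in>H \<theta>. \<forall>C d. club C \<kappa> \<and> kappa_list \<kappa> d \<longrightarrow> E \<theta> x C d)"
    by (elim exE conjE) (rule that)
  obtain \<theta> where \<theta>: "regular \<theta>" "\<alpha>0 \<in> elts \<theta>" "x \<in> H \<theta>"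
    by (rule large_regular_exists[OF \<alpha>0])
  have "E \<theta> x C d"
    by (rule embs[rule_format, OF conjI[OF \<theta>(1,2)] \<theta>(3) conjI[OF assms(2,3)]])
  then obtain M j N where *: "small_embedding \<kappa> \<theta> M j"
    "transitive (elts N)" "ZFC_minus_model (elts N)" "{x, d, C} \<subseteq> j ` elts M"
    "omega1_approximation (elts N) (H \<theta>)" "M \<in> elts N"
    "{a \<in> elts N. elts a \<subseteq> elts (crit j (elts M)) \<and> countable_in (elts N) a} \<subseteq> elts M"
    "app d (crit j (elts M)) \<in> elts N \<longrightarrow> (\<exists>\<alpha>\<in>elts (crit j (elts M)). \<alpha> \<in> elts C \<and>
       elts (app d \<alpha>) = elts (app d (crit j (elts M))) \<inter> elts \<alpha>)"
    unfolding E_def by (elim exE conjE) (rule that)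
  have "internal_small_embedding elts \<kappa> \<theta> M j N" by unfold_locales (fact *)+
  then show thesis by (rule that[OF _ *(4,5,8)])
qed

lemma kappa_list_exists: "\<exists>d. kappa_list \<kappa> d"
  unfolding kappa_list_def
  by (rule exI[of _ "graph (\<lambda>_. set_of {}) \<kappa>"])
    (simp add: function_on_graph app_graph elts_set_of small_empty)

lemma internally_AP_subtle_uncountable:
  assumes "internally_AP_subtle \<kappa>"
  shows "uncountable (elts \<kappa>)"
proof
  assume count: "countable (elts \<kappa>)"
  obtain d where d: "kappa_list \<kappa> d" using kappa_list_exists by blast
  have "club \<kappa> \<kappa>" unfolding club_def unbounded_in_def by blast
  then obtain \<theta> M j N where "internal_small_embedding elts \<kappa> \<theta> M j N"
    by (rule internally_AP_subtle_embedding[OF assms _ d, where x = d]) (rule that)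
  then interpret internal_small_embedding elts \<kappa> \<theta> M j N .
  have "infinite (elts \<kappa>)" using crit_infinite crit_subset finite_subset by blast
  moreover have "countable (elts \<delta>)" using count crit_subset countable_subset by blast
  ultimately obtain g h where "bij_betw g (elts \<delta>) (UNIV :: nat set)" "bij_betw h (elts \<kappa>) (UNIV :: nat set)"
    using crit_infinite count countableE_infinite by metis
  then have "elts \<delta> \<approx> elts \<kappa>" unfolding eqpoll_def by (meson bij_betw_inv_into bij_betw_trans)
  then show False using Card_kappa crit_less unfolding Card_def by blast
qed

text \<open>
  Suppose that f maps \<open>\<mu> < \<kappa>\<close> to \<open>\<kappa>\<close>, and let the embedding have f in its range. The set of
  ordinals from \<open>\<mu>\<close> on is a club in \<open>\<kappa>\<close>, and having it in the range makes \<open>\<mu>\<close> smaller than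
  \<open>\<delta>\<close>. The preimage of f then has its domain and range below \<open>\<delta>\<close>, where nothing is moved, so
  \<open>\<delta>\<close> bounds f.
\<close>

lemma internally_AP_subtle_regular:
  assumes "internally_AP_subtle \<kappa>"
  shows "regular \<kappa>"
  unfolding regular_def
proof (intro conjI ballI allI impI)
  show Card: "Card \<kappa>" using assms unfolding internally_AP_subtle_def by blast
  then have Ord: "Ord \<kappa>" unfolding Card_def by blast
  show "infinite (elts \<kappa>)"
    using internally_AP_subtle_uncountable[OF assms] countable_finite by blast
  fix \<mu> f assume \<mu>: "\<mu> \<in> elts \<kappa>" and f: "f ` elts \<mu> \<subseteq> elts \<kappa>"
  obtain d where d: "kappa_list \<kappa> d" using kappa_list_exists by blast
  define C where "C = set_of {\<xi> \<in> elts \<kappa>. \<mu> = \<xi> \<or> \<mu> \<in> elts \<xi>}"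
  have C: "elts C = {\<xi> \<in> elts \<kappa>. \<mu> = \<xi> \<or> \<mu> \<in> elts \<xi>}"
    unfolding C_def by (rule elts_set_of[OF small_subset[OF small_elts[of \<kappa>]]]) blast
  have "unbounded_in C \<kappa>"
    unfolding unbounded_in_def
  proof
    fix \<alpha> assume \<alpha>: "\<alpha> \<in> elts \<kappa>"
    have "\<alpha> \<in> elts \<mu> \<or> \<alpha> = \<mu> \<or> \<mu> \<in> elts \<alpha>" using Ord \<alpha> \<mu> unfolding Ord_def by blast
    then show "\<exists>\<beta>\<in>elts C \<inter> elts \<kappa>. \<alpha> = \<beta> \<or> \<alpha> \<in> elts \<beta>" using C \<alpha> \<mu> by blast
  qed
  moreover have "\<epsilon> \<in> elts C" if \<epsilon>: "\<epsilon> \<in> elts \<kappa>" "Limit \<epsilon>" "unbounded_in C \<epsilon>" for \<epsilon>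
  proof -
    obtain \<beta> where \<beta>: "\<beta> \<in> elts C" "\<beta> \<in> elts \<epsilon>"
      using \<epsilon>(2,3) unfolding Limit_def unbounded_in_def by blast
    have "\<mu> = \<beta> \<or> \<mu> \<in> elts \<beta>" using \<beta>(1) C by simp
    then have "\<mu> \<in> elts \<epsilon>" using \<beta>(2) Ord_trans[OF Ord_mem[OF Ord \<epsilon>(1)] _ \<beta>(2)] by blast
    then show ?thesis using C \<epsilon>(1) by simp
  qed
  ultimately have club: "club C \<kappa>" unfolding club_def using C by blast
  obtain \<theta> M j N where emb: "internal_small_embedding elts \<kappa> \<theta> M j N"
    and ran: "{graph f \<mu>, d, C} \<subseteq> j ` elts M"
    by (rule internally_AP_subtle_embedding[OF assms club d, where x = "graph f \<mu>"]) (rule that)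
  interpret internal_small_embedding elts \<kappa> \<theta> M j N by (rule emb)
  obtain C' g where C': "C' \<in> elts M" "j C' = C" and g: "g \<in> elts M" "j g = graph f \<mu>"
    using ran by auto
  have "unbounded_in C \<delta>" using crit_in_club(1)[OF C'(1)] C'(2) club by simp
  then obtain \<beta> where \<beta>: "\<beta> \<in> elts C" "\<beta> \<in> elts \<delta>"
    using Limit_crit unfolding Limit_def unbounded_in_def by blast
  have "\<mu> = \<beta> \<or> \<mu> \<in> elts \<beta>" using \<beta>(1) C by simp
  then have \<mu>\<delta>: "\<mu> \<in> elts \<delta>" using \<beta>(2) Ord_trans[OF Ord_crit _ \<beta>(2)] by blast
  have "f \<xi> \<in> elts \<delta>" if \<xi>: "\<xi> \<in> elts \<mu>" for \<xi>
  proof -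
    have "function_on (j g) \<mu>" using g(2) function_on_graph by simp
    then obtain y where y: "y \<in> elts M" "j y = app (j g) \<xi>"
      using app_below_crit[OF g(1) _ \<xi> Ord_trans[OF Ord_crit \<xi> \<mu>\<delta>]] by blast
    have jy: "j y = f \<xi>" using y(2) g(2) app_graph[OF \<xi>] by simp
    then have "j y \<in> elts (j \<delta>)" using f \<xi> j_crit by auto
    then have "y \<in> elts \<delta>" using j_mem_iff[OF y(1) crit_in_M] by simp
    then show ?thesis using j_fixes jy by metis
  qed
  then show "\<exists>\<beta>\<in>elts \<kappa>. \<forall>\<xi>\<in>elts \<mu>. f \<xi> \<in> elts \<beta>" using crit_less by blast
qed

lemma internally_AP_subtle_imp_SSP:
  assumes "internally_AP_subtle \<kappa>"
  shows "SSP \<kappa>"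
  unfolding SSP_def
proof (intro conjI allI impI; (elim conjE)?)
  show "regular \<kappa>" by (rule internally_AP_subtle_regular[OF assms])
  show "uncountable (elts \<kappa>)" by (rule internally_AP_subtle_uncountable[OF assms])
  fix d C assume d: "kappa_list \<kappa> d" and "slender \<kappa> d" and C: "club C \<kappa>"
  then obtain C0 where C0: "club C0 \<kappa>" and slender: "\<And>\<gamma> \<alpha>. \<gamma> \<in> elts C0 \<Longrightarrow> \<alpha> \<in> elts \<gamma> \<Longrightarrow>
      \<exists>\<beta>\<in>elts \<gamma>. elts (app d \<gamma>) \<inter> elts \<alpha> = elts (app d \<beta>) \<inter> elts \<alpha>"
    unfolding slender_def by blast
  obtain \<theta> M j N where emb: "internal_small_embedding elts \<kappa> \<theta> M j N"
    and ran: "{C0, d, C} \<subseteq> j ` elts M"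
    and approx: "omega1_approximation (elts N) (H \<theta>)"
    and guess: "app d (crit j (elts M)) \<in> elts N \<longrightarrow> (\<exists>\<alpha>\<in>elts (crit j (elts M)). \<alpha> \<in> elts C \<and>
       elts (app d \<alpha>) = elts (app d (crit j (elts M))) \<inter> elts \<alpha>)"
    by (rule internally_AP_subtle_embedding[OF assms C d, where x = C0]) (rule that)
  interpret internal_small_embedding elts \<kappa> \<theta> M j N by (rule emb)
  obtain C0' d' C' where pre: "C0' \<in> elts M" "j C0' = C0" "d' \<in> elts M" "j d' = d"
    "C' \<in> elts M" "j C' = C"
    using ran by auto
  have "\<delta> \<in> elts C0" using crit_in_club(2)[OF pre(1)] pre(2) C0 by simp
  then have "app d \<delta> \<in> elts N"
    using slender_value_in_model[OF approx pre(3)] pre(4) d slender by simp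
  then obtain \<alpha> where "\<alpha> \<in> elts \<delta>" "\<alpha> \<in> elts C" "elts (app d \<alpha>) = elts (app d \<delta>) \<inter> elts \<alpha>"
    using guess by blast
  moreover have "\<delta> \<in> elts C" using crit_in_club(2)[OF pre(5)] pre(6) C by simp
  ultimately show "\<exists>\<alpha>\<in>elts C. \<exists>\<beta>\<in>elts C. \<alpha> \<in> elts \<beta> \<and>
      elts (app d \<alpha>) = elts (app d \<beta>) \<inter> elts \<alpha>" by blast
qed

end

theorem lemma8p3:
  fixes elts :: "'v \<Rightarrow> 'v set" and \<kappa> :: 'v
  assumes "ZFC_universe elts"
    and "ZFC_universe.internally_AP_subtle elts \<kappa>"
  shows "ZFC_universe.SSP elts \<kappa>"
  by (rule ZFC_universe.internally_AP_subtle_imp_SSP[OF assms])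

end
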